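(* Let $\nu\in\mathcal{M}$. Then there is a unique function $\psi:[0,1]\to[0,1]$ of the class $\mathcal{G}$ such that the distribution of the derivative $\psi'$ (with respect to Lebesgue measure on $[0,1]$) is $\nu$. Moreover, the map $\nu\mapsto\psi$ is a continuous map $\mathcal{M}\to\mathrm{Gms}([0,1])$.
   Context: $\mathbb{R}^\times$ is the set of positive reals, with coordinate $t$. $\mathcal{M}$ is the space of all measures $\nu$ on $\mathbb{R}^\times$ with $\int_{\mathbb{R}^\times}d\nu(t)=1$ and $\int_{\mathbb{R}^\times}t\,d\nu(t)=1$, with the topology in which $\nu^j\to\nu$ iff $\nu^j\to\nu$ and $t\nu^j\to t\nu$ weakly ($t\nu$ is the measure with density $t$ with respect to $\nu$). A function $h:[0,1]\to[0,1]$ belongs to the class $\mathcal{G}$ if $h$ is (downward) convex, $h(0)=0$, $h(1)=1$, and $h(x)>0$ for $x>0$. The function $\psi$ is regarded as a transformation of $[0,1]$. $\mathrm{Gms}([0,1])$ is the group of all invertible measurable transformations $g$ of $[0,1]$ (identified if equal a.e.) leaving Lebesgue measure $\mu$ quasi-invariant (images and preimages of null sets are null). $g'$ denotes the Radon--Nikodym derivative, $\mu(gA)=\int_A g'\,d\mu$. For measurable $A,B\subset [0,1]$, $\kappa[g;A,B]$ is the measure on $\mathbb{R}^\times$ given by $\kappa[g;A,B](E)=\mu\{x\in A\cap g^{-1}(B): g'(x)\in E\}$. Topology on $\mathrm{Gms}([0,1])$: the coarsest topology such that for all measurable $A,B$ the maps $g\mapsto\kappa[g;A,B]$ and $g\mapsto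 t\kappa[g;A,B]$ are continuous for weak convergence of finite measures on $\mathbb{R}^\times$ (so $g_j\to g$ iff both sequences of measures converge weakly for all $A,B$). *)

theory Defs
  imports "HOL-Analysis.Analysis"
begin

text \<open>The coarsest topology on \<open>S\<close> that makes all \<open>f \<in> F\<close> continuous into \<open>T\<close>, for maps in \<open>F\<close>
  that send \<open>S\<close> into \<open>topspace T\<close>.\<close>

definition initial_topology :: "'a set \<Rightarrow> ('a \<Rightarrow> 'b) set \<Rightarrow> 'b topology \<Rightarrow> 'a topology"
  where "initial_topology S F T =
    topology_generated_by (insert S {{x \<in> S. f x \<in> U} | f U. f \<in> F \<and> openin T U})"

subsection \<open>Measures on the positive reals\<close>

abbreviation borel_pos :: "real measure"
  where "borel_pos \<equiv> restrict_space borel {0<..}"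

definition finite_measures_pos :: "real measure set"
  where "finite_measures_pos = {\<nu>. sets \<nu> = sets borel_pos \<and> finite_measure \<nu>}"

definition weak_topology :: "real measure topology"
  where "weak_topology =
    initial_topology finite_measures_pos
      {(\<lambda>\<nu>. \<integral>t. f t \<partial>\<nu>) | f. continuous_on {0<..} f \<and> bounded (f ` {0<..})}
      euclideanreal"

text \<open>The measure \<open>t\<nu>\<close>, with density \<open>t\<close> with respect to \<open>\<nu>\<close>.\<close>

definition times_t :: "real measure \<Rightarrow> real measure"
  where "times_t \<nu> = density \<nu> (\<lambda>t. ennreal t)"

definition measures_M :: "real measure set"
  where "measures_M = {\<nu>. sets \<nu> = sets borel_pos \<and>
    (\<integral>\<^sup>+t. 1 \<partial>\<nu>) = 1 \<and> (\<integral>\<^sup>+t. ennreal t \<partial>\<nu>) = 1}"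

definition topology_M :: "real measure topology"
  where "topology_M = initial_topology measures_M {(\<lambda>\<nu>. \<nu>), times_t} weak_topology"

subsection \<open>The class of convex functions\<close>

text \<open>Functions on \<open>[0,1]\<close> are represented by functions that are \<open>undefined\<close> outside \<open>[0,1]\<close>,
  so that equality of representatives is equality on \<open>[0,1]\<close>.\<close>

definition class_G :: "(real \<Rightarrow> real) set"
  where "class_G = {h \<in> {0..1} \<rightarrow>\<^sub>E {0..1}.
    convex_on {0..1} h \<and> h 0 = 0 \<and> h 1 = 1 \<and> (\<forall>x\<in>{0..1}. x > 0 \<longrightarrow> h x > 0)}"

abbreviation mu :: "real measure"
  where "mu \<equiv> lebesgue_on {0..1}"

text \<open>A function in \<^const>\<open>class_G\<close> is differentiable with positive derivative outside a countable
  subset of \<open>[0,1]\<close>. The arbitrary values of \<^const>\<open>deriv\<close> on that null set (which contains the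
  end points) do not affect the distribution.\<close>

definition deriv_distribution :: "(real \<Rightarrow> real) \<Rightarrow> real measure"
  where "deriv_distribution h = distr mu borel_pos (deriv h)"

subsection \<open>Transformations with quasi-invariant measure\<close>

definition qi_transformations :: "(real \<Rightarrow> real) set"
  where "qi_transformations = {g. bij_betw g {0..1} {0..1} \<and>
    g \<in> mu \<rightarrow>\<^sub>M mu \<and> (\<forall>A\<in>sets mu. g ` A \<in> sets mu) \<and>
    (\<forall>N\<in>null_sets mu. g ` N \<in> null_sets mu \<and> g -` N \<inter> {0..1} \<in> null_sets mu)}"

definition ae_equal :: "((real \<Rightarrow> real) \<times> (real \<Rightarrow> real)) set"
  where "ae_equal = {(g, h). g \<in> qi_transformations \<and> h \<in> qi_transformations \<and>
    (AE x in mu. g x = h x)}"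

definition Gms :: "(real \<Rightarrow> real) set set"
  where "Gms = qi_transformations // ae_equal"

definition rn_derivative :: "(real \<Rightarrow> real) \<Rightarrow> real \<Rightarrow> real"
  where "rn_derivative g x =
    enn2real (RN_deriv mu (measure_of {0..1} (sets mu) (\<lambda>A. emeasure mu (g ` A))) x)"

definition kappa :: "(real \<Rightarrow> real) \<Rightarrow> real set \<Rightarrow> real set \<Rightarrow> real measure"
  where "kappa g A B = measure_of {0<..} (sets borel_pos)
    (\<lambda>E. emeasure mu {x \<in> A \<inter> g -` B. rn_derivative g x \<in> E})"

lemma equiv_ae_equal: "equiv qi_transformations ae_equal"
proof (rule equivI)
  show "refl_on qi_transformations ae_equal"
    by (auto simp: refl_on_def ae_equal_def)
  show "sym ae_equal"
  proof (rule symI)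
    fix f g assume fg: "(f, g) \<in> ae_equal"
    then have "AE x in mu. f x = g x"
      by (simp add: ae_equal_def)
    then have "AE x in mu. g x = f x"
      by eventually_elim simp
    then show "(g, f) \<in> ae_equal"
      using fg by (simp add: ae_equal_def)
  qed
  show "trans ae_equal"
  proof (rule transI)
    fix f g h assume fg: "(f, g) \<in> ae_equal" and gh: "(g, h) \<in> ae_equal"
    have "AE x in mu. f x = g x" "AE x in mu. g x = h x"
      using fg gh by (auto simp: ae_equal_def)
    then have "AE x in mu. f x = h x"
      by eventually_elim simp
    then show "(f, h) \<in> ae_equal"
      using fg gh by (simp add: ae_equal_def)
  qed
qed (auto simp: ae_equal_def)

lemma rn_derivative_measurable: "rn_derivative g \<in> borel_measurable mu"
  unfolding rn_derivative_def by measurable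

lemma rn_derivative_cong:
  assumes "(g, h) \<in> ae_equal"
  shows "rn_derivative g = rn_derivative h"
proof -
  have g: "g \<in> qi_transformations" and h: "h \<in> qi_transformations"
    and ae: "AE x in mu. g x = h x"
    using assms by (auto simp: ae_equal_def)
  obtain N where N: "N \<in> null_sets mu" "{x \<in> space mu. g x \<noteq> h x} \<subseteq> N"
    using ae by (auto simp: eventually_ae_filter)
  have "emeasure mu (g ` A) = emeasure mu (h ` A)" if A: "A \<in> sets mu" for A
  proof (rule emeasure_eq_AE)
    show "g ` A \<in> sets mu" "h ` A \<in> sets mu"
      using g h A by (auto simp: qi_transformations_def)
    have null: "g ` N \<union> h ` N \<in> null_sets mu"
      using g h N by (auto simp: qi_transformations_def)
    have sub: "A \<subseteq> space mu"
      using A sets.sets_into_space by blast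
    have agree: "g x = h x" if "x \<in> A" "x \<notin> N" for x
      using that sub N(2) by blast
    have "g ` A \<subseteq> h ` A \<union> g ` N" "h ` A \<subseteq> g ` A \<union> h ` N"
      using agree by (force simp: image_iff)+
    then have "{y \<in> space mu. (y \<in> g ` A) \<noteq> (y \<in> h ` A)} \<subseteq> g ` N \<union> h ` N"
      by blast
    then show "AE y in mu. (y \<in> g ` A) = (y \<in> h ` A)"
      by (rule AE_I'[OF null])
  qed
  moreover have "sigma_sets {0..1} (sets mu) = sets mu" "sets mu \<subseteq> Pow {0..1}"
    using sets.sigma_sets_eq[of mu] sets.space_closed[of mu] by simp_all
  ultimately have "measure_of {0..1} (sets mu) (\<lambda>A. emeasure mu (g ` A)) =
      measure_of {0..1} (sets mu) (\<lambda>A. emeasure mu (h ` A))"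
    by (intro measure_of_eq) blast+
  then show ?thesis
    by (simp add: rn_derivative_def fun_eq_iff)
qed

lemma kappa_cong:
  assumes gh: "(g, h) \<in> ae_equal" and A: "A \<in> sets mu" and B: "B \<in> sets mu"
  shows "kappa g A B = kappa h A B"
proof -
  have ae: "AE x in mu. g x = h x"
    using gh by (simp add: ae_equal_def)
  have sub: "A \<subseteq> space mu"
    using A sets.sets_into_space by blast
  have meas: "{x \<in> A \<inter> k -` B. rn_derivative k x \<in> E} \<in> sets mu"
    if k: "k \<in> qi_transformations" and E: "E \<in> sets borel" for k E
  proof -
    have "k -` B \<inter> space mu \<in> sets mu"
      using k B by (intro measurable_sets[of k mu mu]) (auto simp: qi_transformations_def)
    moreover have "rn_derivative k -` E \<inter> space mu \<in> sets mu"
      using measurable_sets[OF rn_derivative_measurable E] .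
    ultimately have "A \<inter> (k -` B \<inter> space mu) \<inter> (rn_derivative k -` E \<inter> space mu) \<in> sets mu"
      using A by auto
    also have "A \<inter> (k -` B \<inter> space mu) \<inter> (rn_derivative k -` E \<inter> space mu) =
        {x \<in> A \<inter> k -` B. rn_derivative k x \<in> E}"
      using sub by auto
    finally show ?thesis .
  qed
  have "emeasure mu {x \<in> A \<inter> g -` B. rn_derivative g x \<in> E} =
      emeasure mu {x \<in> A \<inter> h -` B. rn_derivative h x \<in> E}" if "E \<in> sets borel_pos" for E
  proof (rule emeasure_eq_AE)
    have E: "E \<in> sets borel"
      using that by (auto simp: sets_restrict_space)
    show "{x \<in> A \<inter> g -` B. rn_derivative g x \<in> E} \<in> sets mu"
      "{x \<in> A \<inter> h -` B. rn_derivative h x \<in> E} \<in> sets mu"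
      using meas[OF _ E] gh by (auto simp: ae_equal_def)
    show "AE x in mu. (x \<in> {x \<in> A \<inter> g -` B. rn_derivative g x \<in> E}) =
        (x \<in> {x \<in> A \<inter> h -` B. rn_derivative h x \<in> E})"
      using ae by eventually_elim (simp add: rn_derivative_cong[OF gh])
  qed
  moreover have "sigma_sets {0<..} (sets borel_pos) = sets borel_pos"
      "sets borel_pos \<subseteq> Pow {0<..}"
    using sets.sigma_sets_eq[of borel_pos] sets.space_closed[of borel_pos]
    by (simp_all add: space_restrict_space)
  ultimately show ?thesis
    unfolding kappa_def by (intro measure_of_eq) blast+
qed

text \<open>By \<open>kappa_cong\<close>, \<^const>\<open>kappa\<close> is constant on each class in \<^const>\<open>Gms\<close>.\<close>

definition kappa_class :: "(real \<Rightarrow> real) set \<Rightarrow> real set \<Rightarrow> real set \<Rightarrow> real measure"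
  where "kappa_class C A B = the_elem ((\<lambda>g. kappa g A B) ` C)"

lemma kappa_class_eq:
  assumes "g \<in> qi_transformations" "A \<in> sets mu" "B \<in> sets mu"
  shows "kappa_class (ae_equal `` {g}) A B = kappa g A B"
proof -
  have "g \<in> ae_equal `` {g}"
    using assms(1) by (auto simp: ae_equal_def)
  moreover have "kappa h A B = kappa g A B" if "h \<in> ae_equal `` {g}" for h
    using kappa_cong[of g h A B] that assms(2,3) by simp
  ultimately have "(\<lambda>g. kappa g A B) ` (ae_equal `` {g}) = {kappa g A B}"
    by blast
  then show ?thesis
    by (simp add: kappa_class_def)
qed

definition topology_Gms :: "(real \<Rightarrow> real) set topology"
  where "topology_Gms = initial_topology Gms
    ({(\<lambda>C. kappa_class C A B) | A B. A \<in> sets mu \<and> B \<in> sets mu} \<union>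
     {(\<lambda>C. times_t (kappa_class C A B)) | A B. A \<in> sets mu \<and> B \<in> sets mu})
    weak_topology"

end

theory Submission
  imports Defs "HOL-Probability.Weak_Convergence"
begin

text \<open>The idea is that a function of \<^const>\<open>class_G\<close> is the primitive of its derivative, that this
derivative is an increasing function on \<open>(0,1)\<close>, and that an increasing function is determined
up to a countable set by its distribution: it is the quantile function of that distribution.

Existence: the quantile function \<open>D\<close> of \<open>\<nu>\<close> is increasing and positive, and \<open>\<integral> D = \<integral> t d\<nu>(t) = 1\<close>,
so its primitive \<open>\<psi>(x) = \<integral>\<^sub>0\<^sup>x D\<close> is convex, runs from \<open>0\<close> to \<open>1\<close> and has derivative \<open>D\<close>
wherever \<open>D\<close> is continuous (\<open>measures_M_quantile\<close>, \<open>primitive_in_class_G\<close>).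
Uniqueness: a convex function has a supporting line at every interior point; the slopes \<open>D\<close>
form an increasing function which is the derivative almost everywhere and which determines all
increments of the function. The condition \<open>\<integral> t d\<nu>(t) = 1\<close> excludes a jump at the end point \<open>1\<close>, so
the function is the primitive of \<open>D\<close> on the whole interval (\<open>class_G_is_primitive\<close>).
Both directions speak of supporting slopes only, which are encoded by \<open>has_subgradients\<close>.

The primitive \<open>\<psi>\<close> is an increasing homeomorphism of \<open>[0,1]\<close> that carries \<open>D dx\<close> to Lebesgue measure.
Since \<open>D > 0\<close>, it is quasi-invariant with Radon-Nikodym derivative \<open>D\<close>, and testing \<open>\<kappa>[\<psi>;A,B]\<close> and
\<open>t\<kappa>[\<psi>;A,B]\<close> against a bounded continuous \<open>f\<close> gives the integrals of \<open>f(D)\<close> and \<open>f(D) D\<close> over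
\<open>A \<inter> \<psi>\<^sup>-\<^sup>1 B\<close>.

Continuity: let \<open>\<psi>\<^sub>j\<close>, \<open>\<psi>\<close> be the primitives of \<open>D\<^sub>j\<close>, \<open>D\<close>. Weak convergence of the distributions gives
\<open>D\<^sub>j \<rightarrow> D\<close> at every continuity point of \<open>D\<close>, hence in \<open>L\<^sup>1\<close> by Scheffe's lemma, because all \<open>D\<^sub>j\<close> have
integral \<open>1\<close>; so \<open>\<psi>\<^sub>j \<rightarrow> \<psi>\<close> uniformly. The delicate point is that \<open>\<psi>\<^sub>j\<^sup>-\<^sup>1 B\<close> converges to \<open>\<psi>\<^sup>-\<^sup>1 B\<close> in measure for a merely
measurable \<open>B\<close>. As \<open>D\<^sub>j\<close> is increasing, a set of measure \<open>c\<close> has an image of measure at least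
\<open>\<psi>\<^sub>j(c)\<close>, so preimages of small sets are small uniformly in \<open>j\<close> (\<open>measure_vimage_less\<close>), and \<open>B\<close> can be
squeezed between a compact and an open set (\<open>tendsto_measure_vimage_primitive\<close>). Dominated convergence
then settles both integrals (\<open>kappa_integrals_subsequence\<close>).

These limit theorems concern sequences, whereas the topology on \<^const>\<open>measures_M\<close> is given by
test functions. They apply because convergence of the integrals of countably many test functions,
the steps between two rational points, already forces \<open>D\<^sub>j \<rightarrow> D\<close> almost everywhere
(\<open>continuous_map_real_by_sequences\<close>, \<open>continuous_map_topology_M_sequentially\<close>).\<close>

section \<open>Lebesgue measure on the unit interval\<close>

lemma borel_sets_mu: "A \<in> sets borel \<Longrightarrow> A \<subseteq> {0..1} \<Longrightarrow> A \<in> sets mu"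
  by (auto simp: sets_restrict_space_iff)

lemma borel_measurable_mu [measurable (raw)]: "f \<in> borel_measurable borel \<Longrightarrow> f \<in> borel_measurable mu"
  by (intro measurable_restrict_space1) (simp add: measurable_completion)

lemma measurable_borel_pos:
  assumes "f \<in> borel_measurable M" "\<And>x. 0 < f x"
  shows "f \<in> M \<rightarrow>\<^sub>M borel_pos"
  using assms by (intro measurable_restrict_space2) auto

lemma measure_mu_Ioc: "0 \<le> x \<Longrightarrow> x \<le> y \<Longrightarrow> y \<le> 1 \<Longrightarrow> measure mu {x<..y} = y - x"
  by (subst measure_restrict_space) auto

lemma finite_measure_mu: "finite_measure mu"
  by (rule finite_measureI) (simp add: emeasure_restrict_space)

lemma prob_space_mu: "prob_space mu"
  by (rule prob_spaceI) (simp add: emeasure_restrict_space)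

lemma AE_mu_lebesgue: "AE x in lebesgue. P x \<Longrightarrow> AE x in mu. P x"
  by (subst AE_restrict_space_iff) auto

lemma AE_mu_notin_countable:
  fixes C :: "real set"
  assumes "countable C"
  shows "AE x in mu. x \<notin> C"
proof (rule AE_mu_lebesgue)
  have "AE x in lborel. x \<notin> C"
    using assms by (intro AE_not_in) (simp add: countable_imp_null_set_lborel)
  then show "AE x in lebesgue. x \<notin> C" by (rule AE_completion)
qed

lemma AE_mu_open_interval: "AE x in mu. 0 < x \<and> x < 1"
  using AE_mu_notin_countable[of "{0,1}"] AE_space[of mu] by (auto simp: less_le)

lemma null_sets_mu_subset:
  assumes "N \<in> null_sets mu" "N' \<subseteq> N"
  shows "N' \<in> null_sets mu"
  using assms null_sets_completion_subset[of N' N lborel] by (auto simp: null_sets_restrict_space)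

text \<open>The homeomorphisms below map Borel sets to Borel sets. Lebesgue measurable sets and arbitrary null sets are
treated by splitting off, respectively enlarging to, a Borel set.\<close>

lemma null_sets_mu_borel_cover:
  assumes "N \<in> null_sets mu"
  obtains N' where "N \<subseteq> N'" "N' \<in> sets borel" "N' \<subseteq> {0..1}" "N' \<in> null_sets mu"
proof -
  have "N \<in> null_sets lebesgue" "N \<subseteq> {0..1}"
    using assms by (auto simp: null_sets_restrict_space)
  then obtain C where C: "C \<in> null_sets lborel" "N \<subseteq> C"
    by (auto simp: null_sets_completion_iff2)
  have "C \<inter> {0..1} \<in> null_sets lborel" using C(1) by (intro null_set_Int2) auto
  then have "C \<inter> {0..1} \<in> null_sets mu"
    by (auto simp: null_sets_restrict_space intro: null_sets_completionI)
  then show ?thesis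
    using C \<open>N \<subseteq> {0..1}\<close> by (intro that[of "C \<inter> {0..1}"]) (auto dest: null_setsD2)
qed

lemma sets_mu_borel_Un_null:
  assumes "A \<in> sets mu"
  obtains S N where "A = S \<union> N" "S \<in> sets borel" "S \<subseteq> {0..1}" "N \<in> null_sets mu"
proof -
  have A: "A \<in> sets lebesgue" "A \<subseteq> {0..1}"
    using assms by (auto simp: sets_restrict_space_iff)
  obtain S N N' where *: "A = S \<union> N" "N \<subseteq> N'" "N' \<in> null_sets lborel" "S \<in> sets lborel"
    using A(1) by (rule sets_completionE)
  have "N \<in> null_sets lebesgue"
    using * by (auto simp: null_sets_completion_iff2)
  then have "N \<in> null_sets mu" using * A by (auto simp: null_sets_restrict_space)
  then show ?thesis using * A by (intro that[of S N]) auto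
qed

lemma sets_mu_AE_eq:
  assumes A: "A \<in> sets mu" and B: "B \<subseteq> {0..1}" and AE: "AE x in mu. x \<in> A \<longleftrightarrow> x \<in> B"
  shows "B \<in> sets mu"
proof -
  obtain N where N: "N \<in> null_sets mu" "{x \<in> space mu. \<not> (x \<in> A \<longleftrightarrow> x \<in> B)} \<subseteq> N"
    using AE by (auto simp: eventually_ae_filter)
  have "B = (A - N) \<union> (B \<inter> N)"
  proof (intro set_eqI iffI)
    fix x
    have cases: "x \<in> {0..1} \<Longrightarrow> x \<notin> N \<Longrightarrow> x \<in> A \<longleftrightarrow> x \<in> B" using N(2) by auto
    have "x \<in> A \<Longrightarrow> x \<in> {0..1}" using sets.sets_into_space[OF A] by auto
    then show "x \<in> A - N \<union> B \<inter> N" if "x \<in> B" using cases B that by blast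
    show "x \<in> B" if "x \<in> A - N \<union> B \<inter> N"
      using cases that \<open>x \<in> A \<Longrightarrow> x \<in> {0..1}\<close> by blast
  qed
  moreover have "B \<inter> N \<in> null_sets mu" using N(1) by (rule null_sets_mu_subset) auto
  ultimately show ?thesis using A N(1) by (metis sets.Un sets.Diff null_setsD2)
qed

lemma sets_mu_approximation:
  assumes B: "B \<in> sets mu" and e: "0 < e"
  obtains K U where "compact K" "open U" "K \<subseteq> B" "B \<subseteq> U"
    "(U - K) \<inter> {0..1} \<in> sets mu" "measure mu ((U - K) \<inter> {0..1}) < e"
proof -
  interpret prob_space mu by (rule prob_space_mu)
  have BL: "B \<in> sets lebesgue" "B \<subseteq> {0..1}" using B by (auto simp: sets_restrict_space_iff)
  obtain U where U: "open U" "B \<subseteq> U" "U - B \<in> lmeasurable" "emeasure lebesgue (U - B) < ennreal (e / 2)"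
    using sets_lebesgue_outer_open[OF BL(1), of "e / 2"] e by auto
  obtain K where K: "closed K" "K \<subseteq> B" "B - K \<in> lmeasurable" "emeasure lebesgue (B - K) < ennreal (e / 2)"
    using sets_lebesgue_inner_closed[OF BL(1), of "e / 2"] e by auto
  let ?G = "(U - K) \<inter> {0..1}"
  have G: "?G \<in> sets mu" using U(1) K(1) by (intro borel_sets_mu) (auto intro: sets.Int)
  have "ennreal (measure mu ?G) = emeasure lebesgue ?G"
    using G by (subst emeasure_eq_measure[symmetric]) (simp add: emeasure_restrict_space)
  also have "\<dots> \<le> emeasure lebesgue ((U - B) \<union> (B - K))"
    using U K by (intro emeasure_mono) (auto simp: fmeasurable_def)
  also have "\<dots> \<le> emeasure lebesgue (U - B) + emeasure lebesgue (B - K)"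
    using U K by (intro emeasure_subadditive) (auto simp: fmeasurable_def)
  also have "\<dots> < ennreal (e / 2) + ennreal (e / 2)"
    using U(4) K(4) by (rule add_strict_mono)
  also have "\<dots> = ennreal e" using e by (simp flip: ennreal_plus)
  finally have "measure mu ?G < e" by (simp add: ennreal_less_iff)
  moreover have "compact K"
    using K(1,2) BL(2) bounded_closed_interval bounded_subset[of "{0..1::real}" K]
    by (auto simp: compact_eq_bounded_closed)
  ultimately show ?thesis using U K G that by blast
qed

section \<open>Subgradients of functions on the unit interval\<close>

text \<open>\<open>D x\<close> is the slope of a supporting line of \<open>h\<close> at the interior point \<open>x\<close>. The line has to stay below \<open>h\<close>
up to the end points of the interval, so that the condition yields convexity on the closed interval.\<close>

definition has_subgradients :: "(real \<Rightarrow> real) \<Rightarrow> (real \<Rightarrow> real) \<Rightarrow> bool"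
  where "has_subgradients h D \<longleftrightarrow> (\<forall>x\<in>{0<..<1}. \<forall>y\<in>{0..1}. h x + D x * (y - x) \<le> h y)"

lemma has_subgradientsD:
  "has_subgradients h D \<Longrightarrow> 0 < x \<Longrightarrow> x < 1 \<Longrightarrow> 0 \<le> y \<Longrightarrow> y \<le> 1 \<Longrightarrow> h x + D x * (y - x) \<le> h y"
  by (auto simp: has_subgradients_def)

text \<open>Adding the supporting line inequalities at two points compares the two slopes.\<close>

lemma subgradients_mono:
  assumes "has_subgradients h D"
  shows "mono_on {0<..<1} D"
proof (rule mono_onI)
  fix x y :: real assume xy: "x \<in> {0<..<1}" "y \<in> {0<..<1}" "x \<le> y"
  have "h x + D x * (y - x) \<le> h y" "h y + D y * (x - y) \<le> h x"
    using has_subgradientsD[OF assms] xy by auto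
  then have "D x * (y - x) \<le> D y * (y - x)"
    by (simp add: algebra_simps)
  then show "D x \<le> D y"
    using xy(3) by (cases "x = y") auto
qed

text \<open>The difference quotient between \<open>x\<close> and \<open>z\<close> lies between \<open>D x\<close> and \<open>D z\<close>.\<close>

lemma subgradients_DERIV:
  assumes sub: "has_subgradients h D" and x: "0 < x" "x < 1" and cont: "isCont D x"
  shows "(h has_field_derivative D x) (at x)"
proof -
  have near: "\<forall>\<^sub>F z in at x. z \<in> {0<..<1} - {x}"
    using eventually_at_in_open[of "{0<..<1}" x] x by simp
  have "\<forall>\<^sub>F z in at x. norm ((h z - h x) / (z - x) - D x) \<le> \<bar>D z - D x\<bar>"
    using near
  proof eventually_elim
    case (elim z)
    have 1: "h x + D x * (z - x) \<le> h z" and 2: "h z + D z * (x - z) \<le> h x"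
      using has_subgradientsD[OF sub] elim x by auto
    show ?case
    proof (cases "x < z")
      case True
      then have "D x \<le> (h z - h x) / (z - x)" "(h z - h x) / (z - x) \<le> D z"
        using 1 2 by (simp_all add: field_simps)
      then show ?thesis by simp
    next
      case False
      then have "z < x" using elim by auto
      then have "(h z - h x) / (z - x) \<le> D x" "D z \<le> (h z - h x) / (z - x)"
        using 1 2 by (simp_all add: field_simps)
      then show ?thesis by simp
    qed
  qed
  moreover have "((\<lambda>z. \<bar>D z - D x\<bar>) \<longlongrightarrow> 0) (at x)"
    using cont by (intro tendsto_rabs_zero) (simp add: isCont_def LIM_zero)
  ultimately have "((\<lambda>z. (h z - h x) / (z - x) - D x) \<longlongrightarrow> 0) (at x)"
    by (rule Lim_null_comparison)
  then show ?thesis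
    unfolding has_field_derivative_iff by (rule LIM_zero_cancel)
qed

lemma mono_on_interval_discontinuities:
  fixes D :: "real \<Rightarrow> real"
  assumes "mono_on {0<..<1} D"
  shows "countable {x \<in> {0<..<1}. \<not> isCont D x}"
  using assms by (intro mono_on_ctble_discont_open) auto

lemma AE_mu_isCont:
  fixes D :: "real \<Rightarrow> real"
  assumes "mono_on {0<..<1} D"
  shows "AE x in mu. 0 < x \<and> x < 1 \<and> isCont D x"
  using AE_mu_notin_countable[OF mono_on_interval_discontinuities[OF assms]] AE_mu_open_interval
  by eventually_elim auto

lemma subgradients_deriv_AE:
  assumes "has_subgradients h D"
  shows "AE x in mu. deriv h x = D x"
  using AE_mu_isCont[OF subgradients_mono[OF assms]]
  by eventually_elim (auto intro!: DERIV_imp_deriv subgradients_DERIV[OF assms])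

text \<open>A substitute for the fundamental theorem of calculus. An increment of \<open>h\<close> from \<open>s\<close> to \<open>t\<close> lies between
\<open>D s * (t - s)\<close> and \<open>D t * (t - s)\<close>, and so does the increment of \<open>k\<close>. Their difference is therefore at
most \<open>(D t - D s) * (t - s)\<close>; over \<open>n\<close> equal pieces of \<open>[x,y]\<close> these bounds telescope to
\<open>(D y - D x) * (y - x) / n\<close>, which tends to \<open>0\<close>.\<close>

lemma subgradients_determine_increments:
  assumes h: "has_subgradients h D" and k: "has_subgradients k D"
    and xy: "0 < x" "x \<le> y" "y < 1"
  shows "h y - h x = k y - k x"
proof -
  define e where "e t = h t - k t" for t
  have step: "\<bar>e t - e s\<bar> \<le> (D t - D s) * (t - s)" if "0 < s" "s \<le> t" "t < 1" for s t
  proof -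
    have "h s + D s * (t - s) \<le> h t" "h t + D t * (s - t) \<le> h s"
      "k s + D s * (t - s) \<le> k t" "k t + D t * (s - t) \<le> k s"
      using has_subgradientsD[OF h] has_subgradientsD[OF k] that by auto
    then show ?thesis by (simp add: e_def abs_le_iff algebra_simps)
  qed
  have bound: "real n * \<bar>e y - e x\<bar> \<le> (D y - D x) * (y - x)" for n
  proof (cases "n = 0")
    case True
    have "D x \<le> D y" using xy by (intro mono_onD[OF subgradients_mono[OF h]]) auto
    then show ?thesis using True xy by simp
  next
    case False
    define d where "d = (y - x) / real n"
    define p where "p i = x + real i * d" for i
    have d: "0 \<le> d" using xy by (simp add: d_def)
    have p0: "p 0 = x" and pn: "p n = y" using False by (simp_all add: p_def d_def)
    have pS: "p (Suc i) - p i = d" for i by (simp add: p_def algebra_simps)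
    have pin: "0 < p i" "p i \<le> y" if "i \<le> n" for i
    proof -
      have "real i * d \<le> real n * d" using that d by (intro mult_right_mono) auto
      then show "p i \<le> y" using pn by (simp add: p_def)
      show "0 < p i" using d xy by (simp add: p_def add_pos_nonneg)
    qed
    have "\<bar>e y - e x\<bar> = \<bar>\<Sum>i<n. e (p (Suc i)) - e (p i)\<bar>"
      by (simp add: sum_lessThan_telescope[of "\<lambda>i. e (p i)"] p0 pn)
    also have "\<dots> \<le> (\<Sum>i<n. \<bar>e (p (Suc i)) - e (p i)\<bar>)" by (rule sum_abs)
    also have "\<dots> \<le> (\<Sum>i<n. (D (p (Suc i)) - D (p i)) * d)"
    proof (rule sum_mono)
      fix i assume "i \<in> {..<n}"
      then have i: "i \<le> n" "Suc i \<le> n" by auto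
      have "p i \<le> p (Suc i)" using pS[of i] d by linarith
      then show "\<bar>e (p (Suc i)) - e (p i)\<bar> \<le> (D (p (Suc i)) - D (p i)) * d"
        using step[of "p i" "p (Suc i)"] pS[of i] pin[OF i(1)] pin[OF i(2)] xy by simp
    qed
    also have "\<dots> = (D y - D x) * d"
      by (simp add: sum_distrib_right[symmetric] sum_lessThan_telescope[of "\<lambda>i. D (p i)"] p0 pn)
    finally show ?thesis using False by (simp add: d_def field_simps)
  qed
  have "e y - e x = 0"
  proof (rule ccontr)
    assume "e y - e x \<noteq> 0"
    then obtain n where "(D y - D x) * (y - x) < real n * \<bar>e y - e x\<bar>"
      using ex_less_of_nat_mult[of "\<bar>e y - e x\<bar>"] by auto
    then show False using bound[of n] by simp
  qed
  then show ?thesis by (simp add: e_def)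
qed

lemma convex_has_subgradients:
  assumes "convex_on {0..1} h"
  obtains D where "has_subgradients h D"
proof
  \<comment> \<open>the right derivative of \<open>h\<close>\<close>
  define D where "D x = Inf ((\<lambda>t. (h x - h t) / (x - t)) ` ({x<..} \<inter> {0..1}))" for x
  show "has_subgradients h D"
    unfolding has_subgradients_def D_def
    using convex_le_Inf_differential[OF assms] by (auto simp: interior_atLeastAtMost_real)
qed

text \<open>The supporting line at an intermediate point \<open>z\<close> lies below \<open>h\<close> at \<open>x\<close> and at \<open>y\<close>.\<close>

lemma subgradients_imp_convex:
  assumes D: "has_subgradients h D"
  shows "convex_on {0..1} h"
proof (rule convex_on_linorderI)
  fix t x y :: real assume t: "0 < t" "t < 1" and xy: "x \<in> {0..1}" "y \<in> {0..1}" "x < y"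
  define z where "z = (1 - t) * x + t * y"
  have z1: "z - x = t * (y - x)" and z2: "y - z = (1 - t) * (y - x)"
    by (simp_all add: z_def algebra_simps)
  have "0 < t * (y - x)" "0 < (1 - t) * (y - x)" using t xy by simp_all
  then have z: "0 < z" "z < 1" using xy z1 z2 by auto
  have "h z + D z * (x - z) \<le> h x" "h z + D z * (y - z) \<le> h y"
    using has_subgradientsD[OF D z] xy by auto
  then have "(1 - t) * (h z + D z * (x - z)) + t * (h z + D z * (y - z)) \<le> (1 - t) * h x + t * h y"
    using t by (intro add_mono mult_left_mono) auto
  moreover have "(1 - t) * (h z + D z * (x - z)) + t * (h z + D z * (y - z)) = h z"
    by (simp add: z_def algebra_simps)
  ultimately show "h ((1 - t) *\<^sub>R x + t *\<^sub>R y) \<le> (1 - t) * h x + t * h y"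
    by (simp add: z_def)
qed simp

section \<open>Increasing probability densities and their primitives\<close>

text \<open>The derivatives of the functions \<open>\<psi>\<close> in question. Positivity is demanded everywhere, although monotonicity
is demanded inside the interval only, in order that \<open>D\<close> is a measurable map into the positive reals; an unbounded
\<open>D\<close> cannot be increasing up to the end point \<open>1\<close>.\<close>

locale increasing_density =
  fixes D :: "real \<Rightarrow> real"
  assumes D_borel [measurable]: "D \<in> borel_measurable borel"
    and D_pos: "0 < D x"
    and D_mono: "mono_on {0<..<1} D"
    and D_integrable: "integrable mu D"
    and D_integral: "integral\<^sup>L mu D = 1"

lemma increasing_densityI:
  assumes D: "D \<in> borel_measurable borel" "\<And>x. 0 < D x" "mono_on {0<..<1} D"
    and dist: "distr mu borel_pos D \<in> measures_M"
  shows "increasing_density D"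
proof -
  have Dm: "D \<in> mu \<rightarrow>\<^sub>M borel_pos" using D by (intro measurable_borel_pos) auto
  have "(\<integral>\<^sup>+t. ennreal t \<partial>distr mu borel_pos D) = 1"
    using dist by (simp add: measures_M_def)
  then have int: "(\<integral>\<^sup>+x. ennreal (D x) \<partial>mu) = 1"
    using Dm by (subst (asm) nn_integral_distr) (auto intro: measurable_restrict_space1)
  have "integrable mu D"
    using int D by (intro integrableI_nonneg) (auto simp: less_imp_le)
  moreover have "integral\<^sup>L mu D = 1"
    using int D by (subst integral_eq_nn_integral) (auto simp: less_imp_le)
  ultimately show ?thesis using D by unfold_locales auto
qed

text \<open>The value outside \<open>[0,1]\<close> is the one demanded of the members of \<^const>\<open>class_G\<close>.\<close>

definition primitive :: "(real \<Rightarrow> real) \<Rightarrow> real \<Rightarrow> real"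
  where "primitive D x = (if x \<in> {0..1} then \<integral>s. indicator {..x} s * D s \<partial>mu else undefined)"

context increasing_density
begin

lemma integrable_indicator_times [simp]:
  assumes "A \<in> sets borel"
  shows "integrable mu (\<lambda>s. indicator A s * D s)"
  using assms D_pos
  by (intro Bochner_Integration.integrable_bound[OF D_integrable])
     (auto simp: indicator_def less_imp_le intro!: AE_I2)

lemma primitive_diff:
  assumes "0 \<le> x" "x \<le> y" "y \<le> 1"
  shows "primitive D y - primitive D x = (\<integral>s. indicator {x<..y} s * D s \<partial>mu)"
proof -
  have "primitive D y - primitive D x
      = (\<integral>s. indicator {..y} s * D s - indicator {..x} s * D s \<partial>mu)"
    using assms by (simp add: primitive_def)
  also have "\<dots> = (\<integral>s. indicator {x<..y} s * D s \<partial>mu)"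
    using assms by (intro Bochner_Integration.integral_cong) (auto simp: indicator_def)
  finally show ?thesis .
qed

lemma primitive_mono:
  assumes "0 \<le> x" "x \<le> y" "y \<le> 1"
  shows "primitive D x \<le> primitive D y"
proof -
  have "0 \<le> (\<integral>s. indicator {x<..y} s * D s \<partial>mu)"
    using D_pos by (intro integral_nonneg_AE) (auto simp: less_imp_le)
  then show ?thesis using primitive_diff[OF assms] by simp
qed

lemma integral_const_Ioc:
  assumes "0 \<le> x" "x \<le> y" "y \<le> 1"
  shows "(\<integral>s. indicator {x<..y} s * c \<partial>mu) = (y - x) * (c::real)"
proof -
  have "{x<..y} \<inter> {0..1} = {x<..y}" using assms by auto
  then show ?thesis using assms by (simp add: measure_mu_Ioc)
qed

text \<open>The mean of an increasing function over an interval lies between its values at the end points.\<close>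

lemma primitive_subgradients: "has_subgradients (primitive D) D"
  unfolding has_subgradients_def
proof (intro ballI)
  fix x y :: real assume x: "x \<in> {0<..<1}" and y: "y \<in> {0..1}"
  interpret finite_measure mu by (rule finite_measure_mu)
  have int_const: "integrable mu (\<lambda>s. indicator {a<..b} s * c)" for a b c :: real
    by (intro integrable_const_bound[where B="\<bar>c\<bar>"]) (auto simp: indicator_def)
  show "primitive D x + D x * (y - x) \<le> primitive D y"
  proof (cases "x \<le> y")
    case True
    have le: "(\<integral>s. indicator {x<..y} s * D x \<partial>mu) \<le> (\<integral>s. indicator {x<..y} s * D s \<partial>mu)"
    proof (rule integral_mono_AE)
      show "AE s in mu. indicator {x<..y} s * D x \<le> indicator {x<..y} s * D s"
        using AE_mu_open_interval
        by eventually_elim (use x in \<open>auto simp: indicator_def intro!: mono_onD[OF D_mono]\<close>)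
    qed (rule int_const, simp)
    have "(\<integral>s. indicator {x<..y} s * D x \<partial>mu) = (y - x) * D x"
      using x y True by (intro integral_const_Ioc) auto
    moreover have "primitive D y - primitive D x = (\<integral>s. indicator {x<..y} s * D s \<partial>mu)"
      using x y True by (intro primitive_diff) auto
    ultimately have "(y - x) * D x \<le> primitive D y - primitive D x" using le by linarith
    then show ?thesis by (simp add: mult.commute)
  next
    case False
    have "(\<integral>s. indicator {y<..x} s * D s \<partial>mu) \<le> (\<integral>s. indicator {y<..x} s * D x \<partial>mu)"
    proof (rule integral_mono_AE)
      show "AE s in mu. indicator {y<..x} s * D s \<le> indicator {y<..x} s * D x"
        using AE_mu_open_interval
        by eventually_elim (use x in \<open>auto simp: indicator_def intro!: mono_onD[OF D_mono]\<close>)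
    qed (simp, rule int_const)
    then show ?thesis
      using primitive_diff[of y x] integral_const_Ioc[of y x "D x"] x y False by (simp add: algebra_simps)
  qed
qed

text \<open>The increment over an inner interval \<open>[m,n]\<close> is at least \<open>D m * (n - m)\<close>; the detour through inner points
is due to the slopes being available in the open unit interval only.\<close>

lemma primitive_strict_mono:
  assumes "0 \<le> x" "x < y" "y \<le> 1"
  shows "primitive D x < primitive D y"
proof -
  define m n where "m = (2 * x + y) / 3" and "n = (x + 2 * y) / 3"
  have mn: "x < m" "m < n" "n < y" using assms by (simp_all add: m_def n_def)
  have "primitive D x \<le> primitive D m" "primitive D n \<le> primitive D y"
    using mn assms by (auto intro!: primitive_mono)
  moreover have "primitive D m + D m * (n - m) \<le> primitive D n"
    using has_subgradientsD[OF primitive_subgradients] mn assms by auto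
  moreover have "0 < D m * (n - m)" using mn D_pos by simp
  ultimately show ?thesis by linarith
qed

lemma primitive_0: "primitive D 0 = 0"
proof -
  have "(\<integral>s. indicator {..0} s * D s \<partial>mu) = (\<integral>s. 0 \<partial>mu)"
    using AE_mu_open_interval by (intro integral_cong_AE) (auto simp: indicator_def)
  then show ?thesis by (simp add: primitive_def)
qed

lemma primitive_1: "primitive D 1 = 1"
proof -
  have "(\<integral>s. indicator {..1} s * D s \<partial>mu) = (\<integral>s. D s \<partial>mu)"
    by (intro Bochner_Integration.integral_cong) (auto simp: indicator_def)
  then show ?thesis by (simp add: primitive_def D_integral)
qed

lemma primitive_range:
  assumes "0 \<le> x" "x \<le> 1"
  shows "0 \<le> primitive D x" "primitive D x \<le> 1"
  using primitive_mono[of 0 x] primitive_mono[of x 1] assms by (simp_all add: primitive_0 primitive_1)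

lemma primitive_continuous: "continuous_on {0..1} (primitive D)"
  unfolding continuous_on_sequentially
proof (intro allI ballI impI)
  fix X and x :: real assume x: "x \<in> {0..1}" and X: "(\<forall>n. X n \<in> {0..1}) \<and> X \<longlonglongrightarrow> x"
  have "(\<lambda>n. \<integral>s. indicator {..X n} s * D s \<partial>mu) \<longlonglongrightarrow> (\<integral>s. indicator {..x} s * D s \<partial>mu)"
  proof (rule integral_dominated_convergence[where w=D])
    show "AE s in mu. (\<lambda>n. indicator {..X n} s * D s) \<longlonglongrightarrow> indicator {..x} s * D s"
      using AE_mu_notin_countable[of "{x}", simplified]
    proof eventually_elim
      case (elim s)
      have "\<forall>\<^sub>F n in sequentially. indicator {..X n} s * D s = indicator {..x} s * D s"
      proof (cases "s < x")
        case True
        then have "\<forall>\<^sub>F n in sequentially. s < X n" using X by (intro order_tendstoD(1)) auto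
        then show ?thesis by eventually_elim (use True in \<open>auto simp: indicator_def\<close>)
      next
        case False
        then have "\<forall>\<^sub>F n in sequentially. X n < s" using X elim by (intro order_tendstoD(2)) auto
        then show ?thesis by eventually_elim (use False elim in \<open>auto simp: indicator_def\<close>)
      qed
      then show ?case by (rule tendsto_eventually)
    qed
    show "AE s in mu. norm (indicator {..X n} s * D s) \<le> D s" for n
      using D_pos by (auto simp: indicator_def less_imp_le)
  qed (use D_integrable in simp_all)
  then show "(primitive D \<circ> X) \<longlonglongrightarrow> primitive D x"
    using x X by (simp add: primitive_def comp_def)
qed

end

section \<open>The primitive as a convex function\<close>

text \<open>At the exceptional points \<^term>\<open>deriv h\<close> may take values that are not positive, so it need not be a
measurable map into the positive reals. The two push-forwards are compared as set functions: the preimages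
of a set differ by a null set.\<close>

lemma deriv_distribution_eq:
  assumes sub: "has_subgradients h D" and D: "D \<in> borel_measurable borel" "\<And>x. 0 < D x"
  shows "deriv_distribution h = distr mu borel_pos D"
proof -
  have Dm: "D \<in> mu \<rightarrow>\<^sub>M borel_pos"
    using D by (intro measurable_borel_pos) auto
  have eq: "emeasure mu (deriv h -` E \<inter> space mu) = emeasure mu (D -` E \<inter> space mu)"
    if E: "E \<in> sets borel_pos" for E
  proof (rule emeasure_eq_AE)
    have AE: "AE x in mu. x \<in> D -` E \<inter> space mu \<longleftrightarrow> x \<in> deriv h -` E \<inter> space mu"
      using subgradients_deriv_AE[OF sub] by eventually_elim auto
    show meas: "D -` E \<inter> space mu \<in> sets mu"
      using Dm E by (rule measurable_sets)
    show "deriv h -` E \<inter> space mu \<in> sets mu"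
      by (rule sets_mu_AE_eq[OF meas _ AE]) auto
    show "AE x in mu. x \<in> deriv h -` E \<inter> space mu \<longleftrightarrow> x \<in> D -` E \<inter> space mu"
      using AE by eventually_elim simp
  qed
  have "sigma_sets (space borel_pos) (sets borel_pos) = sets borel_pos"
    by (rule sets.sigma_sets_eq)
  then show ?thesis
    unfolding deriv_distribution_def distr_def
    by (intro measure_of_eq sets.space_closed) (simp add: eq[simplified])
qed

lemma class_G_bounds:
  assumes h: "h \<in> class_G" and x: "0 \<le> x" "x \<le> 1"
  shows "0 \<le> h x" "h x \<le> x"
proof -
  show "0 \<le> h x" using h x by (auto simp: class_G_def PiE_def Pi_def)
  have "convex_on {0..1} h" "h 0 = 0" "h 1 = 1" using h by (auto simp: class_G_def)
  then show "h x \<le> x" using convex_onD[of "{0..1}" h x 0 1] x by simp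
qed

context increasing_density
begin

lemma primitive_in_class_G: "primitive D \<in> class_G"
proof -
  have "primitive D x = undefined" if "x \<notin> {0..1}" for x
    using that by (simp add: primitive_def del: atLeastAtMost_iff)
  moreover have "0 < primitive D x" if "0 < x" "x \<le> 1" for x
    using primitive_strict_mono[of 0 x] that by (simp add: primitive_0)
  ultimately show ?thesis
    using primitive_range subgradients_imp_convex[OF primitive_subgradients]
    by (simp add: class_G_def PiE_def extensional_def Pi_def primitive_0 primitive_1)
qed

lemma deriv_distribution_primitive: "deriv_distribution (primitive D) = distr mu borel_pos D"
  using primitive_subgradients D_borel D_pos by (rule deriv_distribution_eq)

end

text \<open>Any choice of supporting slopes is an increasing density: it has the same distribution as the derivative,
and the members of \<^const>\<open>measures_M\<close> have mean \<open>1\<close>. The function and the primitive of its slopes have equal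
increments inside the interval, and both are squeezed between \<open>0\<close> and \<open>s\<close> at a point \<open>s\<close> close to \<open>0\<close>, hence
they agree.\<close>

lemma class_G_is_primitive:
  assumes h: "h \<in> class_G" and dist: "deriv_distribution h \<in> measures_M"
  obtains D where "increasing_density D" "h = primitive D"
proof -
  have hh: "convex_on {0..1} h" "h 0 = 0" "h 1 = 1" "\<And>x. 0 < x \<Longrightarrow> x \<le> 1 \<Longrightarrow> 0 < h x"
    and h_ext: "h \<in> extensional {0..1}"
    using h by (auto simp: class_G_def PiE_def)
  obtain D0 where D0: "has_subgradients h D0"
    using convex_has_subgradients[OF hh(1)] .
  define D where "D x = (if x \<in> {0<..<1} then D0 x else 1)" for x
  have sub: "has_subgradients h D"
    using D0 by (auto simp: has_subgradients_def D_def)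
  have pos: "0 < D x" for x
  proof (cases "x \<in> {0<..<1}")
    case True
    \<comment> \<open>the supporting line at \<open>x\<close>, evaluated at \<open>0\<close>, shows that \<open>D0 x\<close> is at least \<open>h x / x\<close>\<close>
    then have "0 < h x" "h x + D0 x * (0 - x) \<le> 0"
      using hh has_subgradientsD[OF D0, of x 0] by auto
    then have "0 < D0 x * x" by (simp add: algebra_simps)
    then show ?thesis using True by (simp add: D_def zero_less_mult_iff)
  qed (auto simp: D_def)
  have mono: "mono_on {0<..<1} D" by (rule subgradients_mono[OF sub])
  have [measurable]: "D \<in> borel_measurable borel"
    unfolding D_def using borel_measurable_mono_on_fnc[OF subgradients_mono[OF D0]]
    by (subst measurable_If_restrict_space_iff) (simp_all del: greaterThanLessThan_iff)
  have "deriv_distribution h = distr mu borel_pos D"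
    by (rule deriv_distribution_eq[OF sub _ pos]) simp
  then have inc: "increasing_density D"
    using pos mono dist by (intro increasing_densityI) auto
  interpret increasing_density D by (rule inc)
  have "h x = primitive D x" for x
  proof (cases "x \<in> {0<..<1}")
    case True
    have close: "\<bar>h x - primitive D x\<bar> \<le> s" if "0 < s" "s < x" for s
    proof -
      have "h x - h s = primitive D x - primitive D s"
        using that True by (intro subgradients_determine_increments[OF sub primitive_subgradients]) auto
      moreover have "0 \<le> h s" "h s \<le> s" "0 \<le> primitive D s" "primitive D s \<le> s"
        using class_G_bounds[OF h, of s] class_G_bounds[OF primitive_in_class_G, of s] that True by auto
      ultimately show ?thesis by linarith
    qed
    have "\<bar>h x - primitive D x\<bar> \<le> 0"
    proof (rule dense_ge_bounded)
      show "0 < x" using True by simp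
    qed (rule close)
    then show ?thesis by simp
  next
    case False
    then consider "x = 0" | "x = 1" | "x \<notin> {0..1}" by force
    then show ?thesis
      using hh primitive_0 primitive_1 h_ext by cases (auto simp: extensional_def primitive_def)
  qed
  then have "h = primitive D" by blast
  then show ?thesis using inc that by blast
qed

section \<open>The primitive as a quasi-invariant transformation\<close>

context increasing_density
begin

lemma primitive_bij: "bij_betw (primitive D) {0..1} {0..1}"
proof (rule bij_betw_imageI)
  show "inj_on (primitive D) {0..1}"
  proof (rule inj_onI)
    fix x y :: real assume xy: "x \<in> {0..1}" "y \<in> {0..1}" "primitive D x = primitive D y"
    show "x = y"
      using primitive_strict_mono[of x y] primitive_strict_mono[of y x] xy
      by (cases x y rule: linorder_cases) auto
  qed
  have "\<exists>x\<in>{0..1}. primitive D x = y" if "y \<in> {0..1}" for y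
    using IVT'[of "primitive D" 0 y 1] that primitive_continuous primitive_0 primitive_1 by force
  then show "primitive D ` {0..1} = {0..1}"
    using primitive_range by (intro set_eqI iffI) (auto simp: image_iff)
qed

lemma primitive_le_iff:
  "0 \<le> x \<Longrightarrow> x \<le> 1 \<Longrightarrow> 0 \<le> y \<Longrightarrow> y \<le> 1 \<Longrightarrow> primitive D x \<le> primitive D y \<longleftrightarrow> x \<le> y"
  using primitive_mono[of x y] primitive_strict_mono[of y x] by (auto simp: not_le[symmetric])

lemma primitive_measurable [measurable]: "primitive D \<in> borel_measurable mu"
  using primitive_continuous by (rule continuous_imp_measurable_on_sets_lebesgue) simp

lemma emeasure_density_D:
  assumes "A \<in> sets mu"
  shows "emeasure (density mu (\<lambda>x. ennreal (D x))) A = ennreal (\<integral>x. indicator A x * D x \<partial>mu)"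
proof -
  have "emeasure (density mu (\<lambda>x. ennreal (D x))) A = (\<integral>\<^sup>+x. ennreal (indicator A x * D x) \<partial>mu)"
    using assms by (subst emeasure_density) (auto intro!: nn_integral_cong simp: indicator_def)
  also have "\<dots> = ennreal (\<integral>x. indicator A x * D x \<partial>mu)"
    using assms D_pos
    by (intro nn_integral_eq_integral Bochner_Integration.integrable_bound[OF D_integrable])
       (auto simp: indicator_def less_imp_le intro!: AE_I2)
  finally show ?thesis .
qed

lemma prob_space_density_D: "prob_space (density mu (\<lambda>x. ennreal (D x)))"
proof (rule prob_spaceI)
  have "(\<integral>x. indicator {0..1} x * D x \<partial>mu) = (\<integral>x. D x \<partial>mu)"
    by (intro Bochner_Integration.integral_cong) auto
  then show "emeasure (density mu (\<lambda>x. ennreal (D x))) (space (density mu (\<lambda>x. ennreal (D x)))) = 1"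
    by (simp add: emeasure_density_D D_integral)
qed

text \<open>The primitive carries the measure with density \<open>D\<close> to Lebesgue measure: for \<open>y = primitive D x\<close> the preimage of
\<open>[0,y]\<close> is \<open>[0,x]\<close>, whose mass \<open>\<integral>\<^sub>0\<^sup>x D\<close> is \<open>y\<close> by definition.\<close>

lemma distr_primitive: "distr (density mu (\<lambda>x. ennreal (D x))) borel (primitive D) = distr mu borel (\<lambda>x. x)"
proof (rule cdf_unique)
  interpret DD: prob_space "density mu (\<lambda>x. ennreal (D x))" by (rule prob_space_density_D)
  interpret mu: prob_space mu by (rule prob_space_mu)
  have pm: "primitive D \<in> borel_measurable (density mu (\<lambda>x. ennreal (D x)))" by simp
  show "real_distribution (distr (density mu (\<lambda>x. ennreal (D x))) borel (primitive D))"
    using pm by (rule DD.real_distribution_distr)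
  have im: "(\<lambda>x. x) \<in> borel_measurable mu" by simp
  then show "real_distribution (distr mu borel (\<lambda>x. x))"
    by (rule mu.real_distribution_distr)
  show "cdf (distr (density mu (\<lambda>x. ennreal (D x))) borel (primitive D)) = cdf (distr mu borel (\<lambda>x. x))"
  proof
    fix y :: real
    have c1: "cdf (distr (density mu (\<lambda>x. ennreal (D x))) borel (primitive D)) y
        = DD.prob (primitive D -` {..y} \<inter> {0..1})"
      unfolding cdf_def using pm by (subst measure_distr) auto
    have c2: "cdf (distr mu borel (\<lambda>x. x)) y = mu.prob ({..y} \<inter> {0..1})"
      unfolding cdf_def using im by (subst measure_distr) auto
    consider "y < 0" | "1 < y" | "y \<in> {0..1}" by force
    then show "cdf (distr (density mu (\<lambda>x. ennreal (D x))) borel (primitive D)) y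
        = cdf (distr mu borel (\<lambda>x. x)) y"
    proof cases
      case 1
      then have "primitive D -` {..y} \<inter> {0..1} = {}" "{..y} \<inter> {0..1} = {}"
        using primitive_range by force+
      then show ?thesis by (simp add: c1 c2)
    next
      case 2
      then have "primitive D -` {..y} \<inter> {0..1} = {0..1}" "{..y} \<inter> {0..1} = {0..1}"
        using primitive_range by force+
      then show ?thesis using DD.prob_space mu.prob_space by (simp add: c1 c2)
    next
      case 3
      then obtain x where x: "x \<in> {0..1}" "primitive D x = y"
        using primitive_bij by (metis bij_betw_def imageE)
      then have eq: "primitive D -` {..y} \<inter> {0..1} = {0..x}"
        using primitive_le_iff by auto
      have "DD.prob {0..x} = (\<integral>s. indicator {0..x} s * D s \<partial>mu)"
        using x D_pos by (simp add: measure_def emeasure_density_D borel_sets_mu integral_nonneg_AE less_imp_le)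
      also have "\<dots> = (\<integral>s. indicator {..x} s * D s \<partial>mu)"
        by (intro Bochner_Integration.integral_cong) (auto simp: indicator_def)
      also have "\<dots> = y" using x by (simp add: primitive_def)
      finally have "DD.prob {0..x} = y" .
      moreover have "{..y} \<inter> {0..1} = {0..y}" using 3 by auto
      moreover have "mu.prob {0..y} = y" using 3 by (subst measure_restrict_space) auto
      ultimately show ?thesis by (simp only: c1 c2 eq)
    qed
  qed
qed

lemma image_borel:
  assumes "A \<in> sets borel" "A \<subseteq> {0..1}"
  shows "primitive D ` A \<in> sets borel"
proof -
  define q where "q = inv_into {0..1} (primitive D)"
  have qp: "q (primitive D x) = x" if "x \<in> {0..1}" for x
    using that primitive_bij by (simp add: q_def bij_betw_def)
  have "continuous_on (primitive D ` {0..1}) q"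
    by (rule continuous_on_inv[OF primitive_continuous]) (simp_all add: qp)
  then have "q \<in> borel_measurable (restrict_space borel {0..1})"
    using primitive_bij by (intro borel_measurable_continuous_on_restrict) (simp add: bij_betw_def)
  then have "q -` A \<inter> {0..1} \<in> sets (restrict_space borel {0..1})"
    using assms(1) by (auto dest: measurable_sets simp: space_restrict_space)
  then have "q -` A \<inter> {0..1} \<in> sets borel"
    by (auto simp: sets_restrict_space_iff)
  moreover have "q -` A \<inter> {0..1} = primitive D ` A"
  proof (intro set_eqI iffI)
    fix y assume y: "y \<in> q -` A \<inter> {0..1}"
    then obtain x where "x \<in> {0..1}" "y = primitive D x"
      using primitive_bij by (metis IntD2 bij_betw_def imageE)
    then show "y \<in> primitive D ` A" using y qp by auto
  next
    fix y assume "y \<in> primitive D ` A"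
    then obtain x where "x \<in> A" "x \<in> {0..1}" "y = primitive D x" using assms(2) by auto
    then show "y \<in> q -` A \<inter> {0..1}" using qp primitive_range by auto
  qed
  ultimately show ?thesis by simp
qed

lemma emeasure_vimage_borel:
  assumes "B \<in> sets borel" "B \<subseteq> {0..1}"
  shows "emeasure (density mu (\<lambda>x. ennreal (D x))) (primitive D -` B \<inter> {0..1}) = emeasure mu B"
proof -
  have "emeasure (density mu (\<lambda>x. ennreal (D x))) (primitive D -` B \<inter> {0..1})
      = emeasure (distr (density mu (\<lambda>x. ennreal (D x))) borel (primitive D)) B"
    using assms by (subst emeasure_distr) auto
  also have "\<dots> = emeasure mu B"
    unfolding distr_primitive using assms by (subst emeasure_distr) (auto simp: Int_absorb2)
  finally show ?thesis .
qed

lemma vimage_image: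
  "A \<subseteq> {0..1} \<Longrightarrow> primitive D -` (primitive D ` A) \<inter> {0..1} = A"
  using primitive_bij by (auto simp: bij_betw_def dest: inj_onD subsetD)

lemma emeasure_image_borel:
  assumes "A \<in> sets borel" "A \<subseteq> {0..1}"
  shows "emeasure mu (primitive D ` A) = emeasure (density mu (\<lambda>x. ennreal (D x))) A"
proof -
  have "primitive D ` A \<subseteq> {0..1}" using assms primitive_bij by (auto simp: bij_betw_def)
  then show ?thesis
    using emeasure_vimage_borel[OF image_borel[OF assms]] vimage_image[OF assms(2)] by simp
qed

text \<open>This is where positivity of the density enters: preimages of null sets are null because of it.\<close>

lemma null_sets_density_D: "null_sets (density mu (\<lambda>x. ennreal (D x))) = null_sets mu"
proof -
  have "N \<in> null_sets mu" if N: "N \<in> sets mu" "AE x in mu. x \<in> N \<longrightarrow> ennreal (D x) = 0" for N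
  proof -
    have "AE x in mu. x \<notin> N" using N(2) by eventually_elim (use D_pos in \<open>auto simp: ennreal_eq_0_iff not_le[symmetric]\<close>)
    then show ?thesis using N(1) by (simp add: AE_iff_null_sets)
  qed
  moreover have "AE x in mu. x \<in> N \<longrightarrow> ennreal (D x) = 0" if "N \<in> null_sets mu" for N
    using AE_not_in[OF that] by eventually_elim simp
  ultimately show ?thesis by (auto simp: null_sets_density_iff)
qed

lemma image_null:
  assumes "N \<in> null_sets mu"
  shows "primitive D ` N \<in> null_sets mu"
proof -
  obtain N' where N': "N \<subseteq> N'" "N' \<in> sets borel" "N' \<subseteq> {0..1}" "N' \<in> null_sets mu"
    using assms by (rule null_sets_mu_borel_cover)
  have "primitive D ` N' \<in> sets mu"
    using N' image_borel[of N'] primitive_bij by (intro borel_sets_mu) (auto simp: bij_betw_def)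
  moreover have "emeasure mu (primitive D ` N') = 0"
    using emeasure_image_borel[OF N'(2,3)] N'(4) null_sets_density_D by (metis null_setsD1)
  ultimately have "primitive D ` N' \<in> null_sets mu" by (simp add: null_setsI)
  then show ?thesis by (rule null_sets_mu_subset) (use N' in auto)
qed

lemma vimage_null:
  assumes "N \<in> null_sets mu"
  shows "primitive D -` N \<inter> {0..1} \<in> null_sets mu"
proof -
  obtain N' where N': "N \<subseteq> N'" "N' \<in> sets borel" "N' \<subseteq> {0..1}" "N' \<in> null_sets mu"
    using assms by (rule null_sets_mu_borel_cover)
  have "primitive D -` N' \<inter> {0..1} \<in> sets mu"
    using measurable_sets[OF primitive_measurable N'(2)] by simp
  then have "primitive D -` N' \<inter> {0..1} \<in> null_sets (density mu (\<lambda>x. ennreal (D x)))"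
    using emeasure_vimage_borel[OF N'(2,3)] N'(4) by (intro null_setsI) auto
  then have "primitive D -` N' \<inter> {0..1} \<in> null_sets mu" by (simp add: null_sets_density_D)
  then show ?thesis by (rule null_sets_mu_subset) (use N' in auto)
qed

lemma image_sets:
  assumes "A \<in> sets mu"
  shows "primitive D ` A \<in> sets mu"
    and "emeasure mu (primitive D ` A) = emeasure (density mu (\<lambda>x. ennreal (D x))) A"
proof -
  obtain S N where SN: "A = S \<union> N" "S \<in> sets borel" "S \<subseteq> {0..1}" "N \<in> null_sets mu"
    using assms by (rule sets_mu_borel_Un_null)
  have S: "primitive D ` S \<in> sets mu"
    using SN image_borel[of S] primitive_bij by (intro borel_sets_mu) (auto simp: bij_betw_def)
  have N: "primitive D ` N \<in> null_sets mu" using SN(4) by (rule image_null)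
  have eq: "primitive D ` A = primitive D ` S \<union> primitive D ` N" using SN(1) by auto
  show "primitive D ` A \<in> sets mu" unfolding eq using S N by auto
  have "emeasure (density mu (\<lambda>x. ennreal (D x))) A = emeasure (density mu (\<lambda>x. ennreal (D x))) S"
    unfolding SN(1) using SN null_sets_density_D by (intro emeasure_Un_null_set) (auto simp: borel_sets_mu)
  then show "emeasure mu (primitive D ` A) = emeasure (density mu (\<lambda>x. ennreal (D x))) A"
    unfolding eq using emeasure_Un_null_set[OF S N] emeasure_image_borel[OF SN(2,3)] by simp
qed

lemma vimage_sets:
  assumes "B \<in> sets mu"
  shows "primitive D -` B \<inter> {0..1} \<in> sets mu"
proof -
  obtain S N where SN: "B = S \<union> N" "S \<in> sets borel" "S \<subseteq> {0..1}" "N \<in> null_sets mu"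
    using assms by (rule sets_mu_borel_Un_null)
  have "primitive D -` B \<inter> {0..1} = (primitive D -` S \<inter> {0..1}) \<union> (primitive D -` N \<inter> {0..1})"
    using SN(1) by auto
  moreover have "primitive D -` S \<inter> {0..1} \<in> sets mu"
    using measurable_sets[OF primitive_measurable SN(2)] by simp
  ultimately show ?thesis using vimage_null[OF SN(4)] by auto
qed

lemma primitive_qi: "primitive D \<in> qi_transformations"
proof -
  have "primitive D \<in> mu \<rightarrow>\<^sub>M mu"
    using primitive_range vimage_sets by (intro measurableI) auto
  then show ?thesis
    using primitive_bij image_sets(1) image_null vimage_null by (auto simp: qi_transformations_def)
qed

lemma rn_derivative_primitive: "AE x in mu. rn_derivative (primitive D) x = D x"
proof -
  interpret prob_space mu by (rule prob_space_mu)
  let ?DD = "density mu (\<lambda>x. ennreal (D x))"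
  have "sigma_sets {0..1} (sets mu) = sets mu" "sets mu \<subseteq> Pow {0..1}"
    using sets.sigma_sets_eq[of mu] sets.space_closed[of mu] by simp_all
  then have "measure_of {0..1} (sets mu) (\<lambda>A. emeasure mu (primitive D ` A))
      = measure_of {0..1} (sets mu) (emeasure ?DD)"
    by (intro measure_of_eq) (auto simp: image_sets(2))
  also have "\<dots> = ?DD" using measure_of_of_measure[of ?DD] by simp
  finally have "AE x in mu. ennreal (D x)
      = RN_deriv mu (measure_of {0..1} (sets mu) (\<lambda>A. emeasure mu (primitive D ` A))) x"
    by (intro RN_deriv_unique) auto
  then show ?thesis
    by eventually_elim (metis D_pos enn2real_ennreal less_imp_le rn_derivative_def)
qed

end

section \<open>Densities and their distributions\<close>

lemma measures_M_prob_space: "\<nu> \<in> measures_M \<Longrightarrow> prob_space \<nu>"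
  by (auto simp: measures_M_def intro!: prob_spaceI)

text \<open>The quantile function of \<open>\<nu>\<close> on \<open>(0,1)\<close>, continued by \<open>1\<close>. It is positive since \<open>\<nu>\<close> has no mass on the
nonpositive reals.\<close>

lemma measures_M_quantile:
  assumes \<nu>: "\<nu> \<in> measures_M"
  obtains D where "increasing_density D" "distr mu borel_pos D = \<nu>"
proof -
  interpret \<nu>: prob_space \<nu> using \<nu> by (rule measures_M_prob_space)
  have sets: "sets \<nu> = sets borel_pos" using \<nu> by (simp add: measures_M_def)
  then have space: "space \<nu> = {0<..}" by (simp add: sets_eq_imp_space_eq space_restrict_space)
  have id: "(\<lambda>t. t) \<in> borel_measurable \<nu>"
    using sets by (subst measurable_cong_sets[OF sets refl]) (auto intro: measurable_restrict_space1)
  define N where "N = distr \<nu> borel (\<lambda>t. t)"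
  have "real_distribution N" unfolding N_def using id by (rule \<nu>.real_distribution_distr)
  then interpret N: cdf_distribution N by (simp add: cdf_distribution_def)
  have emN: "emeasure N E = emeasure \<nu> (E \<inter> {0<..})" if "E \<in> sets borel" for E
    using that id space by (simp add: N_def emeasure_distr)
  have "N.C 0 = 0"
  proof -
    have "{..0} \<inter> {0<..} = ({} :: real set)" by auto
    then show ?thesis using emN[of "{..0}"] by (simp add: cdf_def measure_def)
  qed
  then have I_pos: "0 < N.I x" if "0 < x" "x < 1" for x
    using N.pseudoinverse[of x 0] that by auto
  define D where "D x = (if x \<in> {0<..<1} then N.I x else 1)" for x
  have pos: "0 < D x" for x using I_pos by (simp add: D_def)
  have mono: "mono_on {0<..<1} D"
    using N.mono_I by (auto simp: mono_on_def D_def)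
  have [measurable]: "D \<in> borel_measurable borel"
    unfolding D_def using N.measurable_CI by (subst measurable_If_restrict_space_iff) (simp_all del: greaterThanLessThan_iff)
  have Dm: "D \<in> mu \<rightarrow>\<^sub>M borel_pos" using pos by (intro measurable_borel_pos) auto
  have dist: "distr mu borel_pos D = \<nu>"
  proof (rule measure_eqI)
    fix E assume "E \<in> sets (distr mu borel_pos D)"
    then have E: "E \<in> sets borel_pos" by simp
    then have E': "E \<in> sets borel" "E \<subseteq> {0<..}" by (auto simp: sets_restrict_space_iff)
    have DE: "D -` E \<inter> {0<..<1} \<in> sets borel"
      using measurable_sets[of D borel borel E] E' by simp
    have "emeasure (distr mu borel_pos D) E = emeasure mu (D -` E \<inter> {0..1})"
      using Dm E by (simp add: emeasure_distr)
    also have "\<dots> = emeasure mu (D -` E \<inter> {0<..<1})"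
    proof (rule emeasure_eq_AE)
      show "AE x in mu. x \<in> D -` E \<inter> {0..1} \<longleftrightarrow> x \<in> D -` E \<inter> {0<..<1}"
        using AE_mu_open_interval by eventually_elim auto
      show "D -` E \<inter> {0..1} \<in> sets mu" using measurable_sets[OF Dm E] by simp
      show "D -` E \<inter> {0<..<1} \<in> sets mu" using DE by (intro borel_sets_mu) auto
    qed
    also have "\<dots> = emeasure lborel (D -` E \<inter> {0<..<1})"
      using DE by (subst emeasure_restrict_space) auto
    also have "D -` E \<inter> {0<..<1} = N.I -` E \<inter> {0<..<1}" by (auto simp: D_def)
    also have "emeasure lborel (N.I -` E \<inter> {0<..<1})
        = emeasure (distr (restrict_space lborel {0<..<1}) borel N.I) E"
      using E' N.measurable_CI
      by (subst emeasure_distr)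
         (auto simp: emeasure_restrict_space space_restrict_space
           cong: measurable_cong_sets sets_restrict_space_cong)
    also have "\<dots> = emeasure N E" by (simp only: N.distr_I_eq_M)
    also have "\<dots> = emeasure \<nu> E" using emN[OF E'(1)] E'(2) by (simp add: Int_absorb2)
    finally show "emeasure (distr mu borel_pos D) E = emeasure \<nu> E" .
  qed (simp add: sets)
  have "increasing_density D"
    using pos mono dist \<nu> by (intro increasing_densityI) auto
  then show ?thesis using dist that by blast
qed

context increasing_density
begin

lemma D_borel_pos: "D \<in> mu \<rightarrow>\<^sub>M borel_pos"
  using D_pos by (intro measurable_borel_pos) auto

definition cdf_D :: "real \<Rightarrow> real"
  where "cdf_D t = measure mu (D -` {..t} \<inter> {0..1})"

lemma D_vimage_sets: "D -` {..t} \<inter> {0..1} \<in> sets mu"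
  using measurable_sets[of D mu borel "{..t}"] by simp

text \<open>An increasing density is a quantile function of its distribution. This lemma and the next are
the Galois inequalities between the two, in the weak form that is insensitive to the values at jumps.\<close>

lemma le_cdf_D:
  assumes x: "0 < x" "x < 1" and "D x \<le> t"
  shows "x \<le> cdf_D t"
proof -
  interpret prob_space mu by (rule prob_space_mu)
  have "{0<..x} \<subseteq> D -` {..t} \<inter> {0..1}"
  proof
    fix s assume "s \<in> {0<..x}"
    then have "D s \<le> D x" "s \<in> {0..1}" using x by (auto intro!: mono_onD[OF D_mono])
    then show "s \<in> D -` {..t} \<inter> {0..1}" using assms(3) by simp
  qed
  then have "measure mu {0<..x} \<le> cdf_D t"
    unfolding cdf_D_def by (rule finite_measure_mono) (rule D_vimage_sets)
  then show ?thesis using x by (simp add: measure_mu_Ioc)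
qed

lemma cdf_D_le:
  assumes x: "0 < x" "x < 1" and "t < D x"
  shows "cdf_D t \<le> x"
proof -
  interpret prob_space mu by (rule prob_space_mu)
  have "cdf_D t \<le> measure mu {0<..x}"
    unfolding cdf_D_def
  proof (rule finite_measure_mono_AE)
    show "AE s in mu. s \<in> D -` {..t} \<inter> {0..1} \<longrightarrow> s \<in> {0<..x}"
      using AE_mu_open_interval
    proof eventually_elim
      case (elim s)
      have "t < D s" if "x < s"
        using mono_onD[OF D_mono, of x s] elim x that assms(3) by auto
      then show ?case using elim by force
    qed
  qed (use x in \<open>auto intro!: borel_sets_mu\<close>)
  then show ?thesis using x by (simp add: measure_mu_Ioc)
qed

lemma cts_step_cdf_D:
  assumes "p < q"
  shows "cdf_D p \<le> (\<integral>s. cts_step p q (D s) \<partial>mu)" "(\<integral>s. cts_step p q (D s) \<partial>mu) \<le> cdf_D q"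
proof -
  interpret prob_space mu by (rule prob_space_mu)
  have D_meas: "D \<in> borel_measurable mu" by simp
  interpret M: real_distribution "distr mu borel D"
    using D_meas by (rule real_distribution_distr)
  have eq: "(\<integral>s. cts_step p q (D s) \<partial>mu) = integral\<^sup>L (distr mu borel D) (cts_step p q)"
    by (subst integral_distr) (auto simp: cts_step_def[abs_def])
  have cdf: "cdf (distr mu borel D) t = cdf_D t" for t
    using D_meas by (simp add: cdf_def cdf_D_def measure_distr)
  show "cdf_D p \<le> (\<integral>s. cts_step p q (D s) \<partial>mu)" "(\<integral>s. cts_step p q (D s) \<partial>mu) \<le> cdf_D q"
    using M.cdf_cts_step[OF assms] by (simp_all add: eq cdf)
qed

end

text \<open>Let \<open>D x < b\<close>. By continuity \<open>D y < b\<close> for some \<open>y > x\<close>, so the distribution function of \<open>D\<close> is at least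
\<open>y > x\<close> at any \<open>p\<close> between \<open>D y\<close> and \<open>b\<close>. A step function from \<open>p\<close> to \<open>q < b\<close> transfers this strict inequality
to \<open>D\<^sub>j\<close>: for large \<open>j\<close> the distribution function of \<open>D\<^sub>j\<close> exceeds \<open>x\<close> at \<open>q\<close>, whence \<open>D\<^sub>j x \<le> q < b\<close>.
Lower bounds are symmetric. As \<open>p\<close> and \<open>q\<close> can be chosen rational, countably many test functions suffice.\<close>

lemma increasing_densities_converge:
  assumes Ds: "\<And>j. increasing_density (Ds j)" and D: "increasing_density D"
    and conv: "\<And>p q. p \<in> \<rat> \<Longrightarrow> q \<in> \<rat> \<Longrightarrow> p < q \<Longrightarrow>
      (\<lambda>j. \<integral>s. cts_step p q (Ds j s) \<partial>mu) \<longlonglongrightarrow> (\<integral>s. cts_step p q (D s) \<partial>mu)"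
    and x: "0 < x" "x < 1" and cont: "isCont D x"
  shows "(\<lambda>j. Ds j x) \<longlonglongrightarrow> D x"
proof -
  interpret Ds: increasing_density "Ds j" for j by (rule Ds)
  interpret D: increasing_density D by (rule D)
  have near: "\<forall>\<^sub>F y in at x. 0 < y \<and> y < 1"
    using x by (intro eventually_conj order_tendstoD[OF tendsto_ident_at]) auto
  show ?thesis
  proof (rule order_tendstoI)
    fix b assume "D x < b"
    then have "\<forall>\<^sub>F y in at x. D y < b"
      using cont by (auto simp: isCont_def intro: order_tendstoD)
    then have "\<forall>\<^sub>F y in at_right x. (D y < b \<and> 0 < y \<and> y < 1) \<and> x < y"
      using near eventually_at_right_less[of x] by (simp add: eventually_at_split eventually_conj_iff)
    then obtain y where y: "D y < b" "0 < y" "y < 1" "x < y"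
      using eventually_happens'[OF trivial_limit_at_right_real] by blast
    obtain p where p: "p \<in> \<rat>" "D y < p" "p < b" using Rats_dense_in_real[OF y(1)] by blast
    obtain q where q: "q \<in> \<rat>" "p < q" "q < b" using Rats_dense_in_real[OF p(3)] by blast
    have "x < (\<integral>s. cts_step p q (D s) \<partial>mu)"
      using D.le_cdf_D[of y p] D.cts_step_cdf_D(1)[OF q(2)] y p by linarith
    then have "\<forall>\<^sub>F j in sequentially. x < (\<integral>s. cts_step p q (Ds j s) \<partial>mu)"
      using conv[OF p(1) q(1,2)] by (rule order_tendstoD(1)[rotated])
    then show "\<forall>\<^sub>F j in sequentially. Ds j x < b"
    proof eventually_elim
      case (elim j)
      then have "x < Ds.cdf_D j q" using Ds.cts_step_cdf_D(2)[OF q(2), of j] by linarith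
      then have "Ds j x \<le> q" using Ds.cdf_D_le[OF x, of q j] by (meson not_le)
      then show ?case using q by simp
    qed
  next
    fix a assume "a < D x"
    then have "\<forall>\<^sub>F y in at x. a < D y"
      using cont by (auto simp: isCont_def intro: order_tendstoD)
    then have "\<forall>\<^sub>F y in at_left x. (a < D y \<and> 0 < y \<and> y < 1) \<and> y < x"
      using near eventually_at_left_real[OF x(1)]
      by (auto simp: eventually_at_split eventually_conj_iff elim: eventually_mono)
    then obtain y where y: "a < D y" "0 < y" "y < 1" "y < x"
      using eventually_happens'[OF trivial_limit_at_left_real] by blast
    obtain p where p: "p \<in> \<rat>" "a < p" "p < D y" using Rats_dense_in_real[OF y(1)] by blast
    obtain q where q: "q \<in> \<rat>" "p < q" "q < D y" using Rats_dense_in_real[OF p(3)] by blast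
    have "(\<integral>s. cts_step p q (D s) \<partial>mu) < x"
      using D.cdf_D_le[of y q] D.cts_step_cdf_D(2)[OF q(2)] y q by linarith
    then have "\<forall>\<^sub>F j in sequentially. (\<integral>s. cts_step p q (Ds j s) \<partial>mu) < x"
      using conv[OF p(1) q(1,2)] by (rule order_tendstoD(2)[rotated])
    then show "\<forall>\<^sub>F j in sequentially. a < Ds j x"
    proof eventually_elim
      case (elim j)
      then have "Ds.cdf_D j p < x" using Ds.cts_step_cdf_D(1)[OF q(2), of j] by linarith
      then have "p < Ds j x" using Ds.le_cdf_D[OF x, of j p] by (meson not_le)
      then show ?case using p by simp
    qed
  qed
qed

lemma primitive_cong_AE:
  assumes "AE x in mu. D x = D' x" "D \<in> borel_measurable borel" "D' \<in> borel_measurable borel"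
  shows "primitive D = primitive D'"
proof
  fix x
  have [measurable]: "D \<in> borel_measurable mu" "D' \<in> borel_measurable mu" using assms by simp_all
  have "(\<integral>s. indicator {..x} s * D s \<partial>mu) = (\<integral>s. indicator {..x} s * D' s \<partial>mu)"
    using assms(1) by (intro integral_cong_AE) auto
  then show "primitive D x = primitive D' x" by (simp add: primitive_def)
qed

lemma integral_distribution:
  fixes f :: "real \<Rightarrow> real"
  assumes D: "increasing_density D" and f: "f \<in> borel_measurable borel_pos"
  shows "(\<integral>s. f (D s) \<partial>mu) = (\<integral>t. f t \<partial>distr mu borel_pos D)"
  using increasing_density.D_borel_pos[OF D] f by (simp add: integral_distr)

lemma cts_step_borel_pos: "cts_step p q \<in> borel_measurable borel_pos"
  by (intro measurable_restrict_space1) (simp add: cts_step_def[abs_def])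

text \<open>Equality of distributions is the case of a constant sequence in the convergence lemma above.\<close>

lemma distribution_determines_primitive:
  assumes D: "increasing_density D" and D': "increasing_density D'"
    and eq: "distr mu borel_pos D = distr mu borel_pos D'"
  shows "primitive D = primitive D'"
proof (rule primitive_cong_AE)
  interpret D': increasing_density D' by (rule D')
  show "AE x in mu. D x = D' x"
    using AE_mu_isCont[OF D'.D_mono]
  proof eventually_elim
    case (elim x)
    have "(\<lambda>j::nat. D x) \<longlonglongrightarrow> D' x"
      using elim by (intro increasing_densities_converge[of "\<lambda>_. D"] D D')
        (auto simp: integral_distribution D D' cts_step_borel_pos eq)
    then show ?case by (simp add: LIMSEQ_const_iff)
  qed
qed (use D D' in \<open>auto simp: increasing_density_def\<close>)

lemma measures_M_ex1:
  assumes "\<nu> \<in> measures_M"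
  shows "\<exists>!\<psi>. \<psi> \<in> class_G \<and> deriv_distribution \<psi> = \<nu>"
proof -
  obtain D where D: "increasing_density D" "distr mu borel_pos D = \<nu>"
    using assms by (rule measures_M_quantile)
  show ?thesis
  proof (rule ex1I)
    show "primitive D \<in> class_G \<and> deriv_distribution (primitive D) = \<nu>"
      using D increasing_density.primitive_in_class_G increasing_density.deriv_distribution_primitive by auto
  next
    fix \<psi> assume \<psi>: "\<psi> \<in> class_G \<and> deriv_distribution \<psi> = \<nu>"
    then obtain D' where D': "increasing_density D'" "\<psi> = primitive D'"
      using class_G_is_primitive[of \<psi>] assms by blast
    then have "distr mu borel_pos D' = \<nu>"
      using \<psi> increasing_density.deriv_distribution_primitive by metis
    then show "\<psi> = primitive D"
      using distribution_determines_primitive[OF D'(1) D(1)] D' D by simp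
  qed
qed

section \<open>Convergence of the primitives\<close>

context increasing_density
begin

text \<open>Among all sets of measure \<open>c\<close> the interval \<open>[0,c]\<close> has the least integral of the increasing function \<open>D\<close>:
the integral of \<open>D - D c\<close> against the difference of the two indicators is nonnegative, and the constant
\<open>D c\<close> contributes nothing, because both sets have measure \<open>c\<close>.\<close>

lemma primitive_le_set_integral:
  assumes C: "C \<in> sets mu"
  shows "primitive D (measure mu C) \<le> (\<integral>s. indicator C s * D s \<partial>mu)"
proof -
  interpret prob_space mu by (rule prob_space_mu)
  define c where "c = prob C"
  have c: "0 \<le> c" "c \<le> 1" by (simp_all add: c_def)
  have intC: "integrable mu (\<lambda>s. indicator C s * D s)"
    using C D_pos
    by (intro Bochner_Integration.integrable_bound[OF D_integrable])
       (auto simp: indicator_def less_imp_le intro!: AE_I2)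
  consider "c = 0" | "c = 1" | "0 < c" "c < 1" using c by linarith
  then have "primitive D c \<le> (\<integral>s. indicator C s * D s \<partial>mu)"
  proof cases
    case 1
    then show ?thesis using D_pos by (auto simp: primitive_0 less_imp_le intro!: integral_nonneg_AE)
  next
    case 2
    then have "AE s in mu. s \<in> C" using C prob_eq_1 by (simp add: c_def)
    then have "(\<integral>s. indicator C s * D s \<partial>mu) = (\<integral>s. D s \<partial>mu)"
      using C by (intro integral_cong_AE) auto
    then show ?thesis using 2 by (simp add: primitive_1 D_integral)
  next
    case 3
    define g :: "real \<Rightarrow> real" where "g s = indicator C s - indicator {..c} s" for s :: real
    have ind: "integrable mu (indicator C :: real \<Rightarrow> real)" "integrable mu (indicator {..c} :: real \<Rightarrow> real)"
      using C by (auto intro!: integrable_const_bound[where B=1] simp: indicator_def)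
    have "{..c} \<inter> {0..1} = {0..c}" using 3 by auto
    moreover have "prob {0..c} = c" using 3 by (subst measure_restrict_space) auto
    moreover have "C \<inter> {0..1} = C" using sets.sets_into_space[OF C] by auto
    ultimately have g0: "(\<integral>s. g s \<partial>mu) = 0"
      unfolding g_def using ind 3 by (simp add: c_def[symmetric] min_def)
    have gi: "integrable mu g" unfolding g_def using ind by simp
    have gD: "g s * D s = indicator C s * D s - indicator {..c} s * D s" for s
      by (simp add: g_def algebra_simps)
    have "0 = (\<integral>s. g s * D c \<partial>mu)" using g0 by simp
    also have "\<dots> \<le> (\<integral>s. g s * D s \<partial>mu)"
    proof (rule integral_mono_AE)
      show "integrable mu (\<lambda>s. g s * D c)" using gi by simp
      show "integrable mu (\<lambda>s. g s * D s)" unfolding gD using intC by simp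
      show "AE s in mu. g s * D c \<le> g s * D s"
        using AE_mu_open_interval
      proof eventually_elim
        case (elim s)
        show ?case
          using mono_onD[OF D_mono, of s c] mono_onD[OF D_mono, of c s] elim 3
          by (cases "s \<le> c"; cases "s \<in> C") (auto simp: g_def)
      qed
    qed
    also have "\<dots> = (\<integral>s. indicator C s * D s \<partial>mu) - (\<integral>s. indicator {..c} s * D s \<partial>mu)"
      unfolding gD using intC by simp
    finally show ?thesis using 3 by (simp add: primitive_def)
  qed
  then show ?thesis by (simp add: c_def)
qed

text \<open>Preimages of small sets are small, with a bound that depends on \<open>D\<close> only through a single value of
its primitive. Such values converge along with the primitives, so the bound is uniform along a convergent
sequence.\<close>

lemma measure_vimage_less:
  assumes B: "B \<in> sets mu" and "0 < e" "e \<le> 1" and less: "measure mu B < primitive D e"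
  shows "measure mu (primitive D -` B \<inter> {0..1}) < e"
proof (rule ccontr)
  interpret prob_space mu by (rule prob_space_mu)
  let ?C = "primitive D -` B \<inter> {0..1}"
  assume "\<not> measure mu ?C < e"
  have "ennreal (\<integral>s. indicator ?C s * D s \<partial>mu) = ennreal (prob (primitive D ` ?C))"
    using vimage_sets[OF B] by (simp add: image_sets(2) emeasure_density_D emeasure_eq_measure[symmetric])
  then have im: "(\<integral>s. indicator ?C s * D s \<partial>mu) = prob (primitive D ` ?C)"
    using D_pos by (subst (asm) ennreal_inj) (auto intro!: integral_nonneg_AE simp: less_imp_le)
  have "primitive D e \<le> primitive D (prob ?C)"
    using assms \<open>\<not> prob ?C < e\<close> by (intro primitive_mono) auto
  also have "\<dots> \<le> (\<integral>s. indicator ?C s * D s \<partial>mu)"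
    using vimage_sets[OF B] by (rule primitive_le_set_integral)
  also note im
  also have "prob (primitive D ` ?C) \<le> prob B" using B by (intro finite_measure_mono) auto
  finally show False using less by simp
qed

end

lemma primitive_diff_le:
  assumes D: "increasing_density D" and D': "increasing_density D'" and x: "0 \<le> x" "x \<le> 1"
  shows "\<bar>primitive D x - primitive D' x\<bar> \<le> (\<integral>s. \<bar>D s - D' s\<bar> \<partial>mu)"
proof -
  interpret D: increasing_density D by (rule D)
  interpret D': increasing_density D' by (rule D')
  have "primitive D x - primitive D' x = (\<integral>s. indicator {..x} s * D s - indicator {..x} s * D' s \<partial>mu)"
    using x by (simp add: primitive_def)
  also have "\<bar>\<dots>\<bar> \<le> (\<integral>s. \<bar>indicator {..x} s * D s - indicator {..x} s * D' s\<bar> \<partial>mu)"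
    by (rule integral_abs_bound)
  also have "\<dots> \<le> (\<integral>s. \<bar>D s - D' s\<bar> \<partial>mu)"
  proof (rule integral_mono)
    show "integrable mu (\<lambda>s. \<bar>indicator {..x} s * D s - indicator {..x} s * D' s\<bar>)"
      by (intro integrable_abs Bochner_Integration.integrable_diff
          D.integrable_indicator_times D'.integrable_indicator_times) simp_all
    show "integrable mu (\<lambda>s. \<bar>D s - D' s\<bar>)"
      using D.D_integrable D'.D_integrable by simp
  qed (auto simp: indicator_def)
  finally show ?thesis .
qed

text \<open>Choose \<open>K \<subseteq> B \<subseteq> U\<close> with \<open>K\<close> compact, \<open>U\<close> open and \<open>U - K\<close> small. If exactly one of the two nearby points
\<open>\<psi>\<^sub>j s\<close> and \<open>\<psi> s\<close> lies in \<open>B\<close>, then one of them lies in \<open>U - K\<close>, since points of \<open>K\<close> have a positive distance from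
the complement of \<open>U\<close>. The preimages of \<open>U - K\<close> under both maps are small.\<close>

lemma tendsto_measure_vimage_primitive:
  assumes Ds: "\<And>j. increasing_density (Ds j)" and D: "increasing_density D"
    and L1: "(\<lambda>j. \<integral>s. \<bar>Ds j s - D s\<bar> \<partial>mu) \<longlonglongrightarrow> 0" and B: "B \<in> sets mu"
  shows "(\<lambda>j. \<integral>s. \<bar>indicator B (primitive (Ds j) s) - indicator B (primitive D s)\<bar> \<partial>mu) \<longlonglongrightarrow> (0::real)"
proof (rule order_tendstoI)
  interpret Ds: increasing_density "Ds j" for j by (rule Ds)
  interpret D: increasing_density D by (rule D)
  interpret prob_space mu by (rule prob_space_mu)
  fix e :: real assume e: "0 < e"
  define d where "d = min 1 (e / 2)"
  have d: "0 < d" "d \<le> 1" "d \<le> e / 2" using e by (auto simp: d_def)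
  \<comment> \<open>the factor leaves room for \<open>primitive (Ds j) d\<close> to be smaller than \<open>primitive D d\<close>\<close>
  define c where "c = primitive D d / 2"
  have c: "0 < c" using D.primitive_strict_mono[of 0 d] d by (simp add: c_def D.primitive_0)
  obtain K U where KU: "compact K" "open U" "K \<subseteq> B" "B \<subseteq> U"
    and G: "(U - K) \<inter> {0..1} \<in> sets mu" "prob ((U - K) \<inter> {0..1}) < c"
    using sets_mu_approximation[OF B c] .
  let ?G = "(U - K) \<inter> {0..1}"
  obtain r where r: "0 < r" "\<And>x y. x \<in> K \<Longrightarrow> y \<notin> U \<Longrightarrow> r \<le> dist x y"
  proof -
    have "K \<inter> - U = {}" using KU by auto
    then show ?thesis
      using separate_compact_closed[of K "- U"] KU that by (auto simp: closed_Compl)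
  qed
  have "\<forall>\<^sub>F j in sequentially. (\<integral>s. \<bar>Ds j s - D s\<bar> \<partial>mu) < min r c"
    using L1 r c by (intro order_tendstoD(2)) auto
  then show "\<forall>\<^sub>F j in sequentially. (\<integral>s. \<bar>indicator B (primitive (Ds j) s) - indicator B (primitive D s)\<bar> \<partial>mu) < e"
  proof eventually_elim
    case (elim j)
    have close: "\<bar>primitive (Ds j) x - primitive D x\<bar> < min r c" if "x \<in> {0..1}" for x
      using primitive_diff_le[OF Ds D, of x j] that elim by auto
    let ?V = "primitive (Ds j) -` ?G \<inter> {0..1}" and ?W = "primitive D -` ?G \<inter> {0..1}"
    have "\<bar>primitive (Ds j) d - primitive D d\<bar> < c" "primitive D d = 2 * c"
      using close[of d] d by (simp_all add: c_def)
    then have "prob ?G < primitive (Ds j) d" using G(2) by linarith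
    then have V: "prob ?V < d" using d by (intro Ds.measure_vimage_less G(1))
    have W: "prob ?W < d"
      using d G(2) c by (intro D.measure_vimage_less G(1)) (auto simp: c_def)
    have VW: "?V \<in> sets mu" "?W \<in> sets mu"
      using Ds.vimage_sets[OF G(1)] D.vimage_sets[OF G(1)] by auto
    have int_VW: "integrable mu (indicator (?V \<union> ?W) :: real \<Rightarrow> real)"
      using VW by (intro integrable_const_bound[where B=1]) (auto simp: indicator_def)
    have "(\<integral>s. \<bar>indicator B (primitive (Ds j) s) - indicator B (primitive D s)\<bar> \<partial>mu)
        \<le> (\<integral>s. (indicator (?V \<union> ?W) s :: real) \<partial>mu)"
    proof (rule integral_mono_AE')
      show "AE s in mu. \<bar>indicator B (primitive (Ds j) s) - indicator B (primitive D s)\<bar>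
          \<le> (indicator (?V \<union> ?W) s :: real)"
      proof (rule AE_I2)
        fix s assume "s \<in> space mu"
        then have s: "s \<in> {0..1}" by simp
        define a b where "a = primitive (Ds j) s" and "b = primitive D s"
        have ab: "a \<in> {0..1}" "b \<in> {0..1}"
          using s Ds.primitive_range D.primitive_range by (auto simp: a_def b_def)
        have lt: "dist a b < r" using close[OF s] by (simp add: a_def b_def dist_real_def)
        have "a \<in> ?G \<or> b \<in> ?G" if "(a \<in> B) \<noteq> (b \<in> B)"
        proof (rule ccontr)
          assume "\<not> (a \<in> ?G \<or> b \<in> ?G)"
          then have "(a \<in> K \<and> b \<notin> U) \<or> (b \<in> K \<and> a \<notin> U)" using that ab KU by auto
          then show False using r(2)[of a b] r(2)[of b a] lt by (auto simp: dist_commute)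
        qed
        then show "\<bar>indicator B (primitive (Ds j) s) - indicator B (primitive D s)\<bar>
            \<le> (indicator (?V \<union> ?W) s :: real)"
          using s unfolding a_def[symmetric] b_def[symmetric]
          by (cases "a \<in> B"; cases "b \<in> B") (auto simp: a_def b_def)
      qed
    qed (use int_VW in auto)
    also have "\<dots> = prob (?V \<union> ?W)"
    proof -
      have "(?V \<union> ?W) \<inter> {0..1} = ?V \<union> ?W" by auto
      then show ?thesis by simp
    qed
    also have "\<dots> \<le> prob ?V + prob ?W" using VW by (rule measure_Un_le)
    also have "\<dots> < e" using V W d by linarith
    finally show ?case .
  qed
next
  fix e :: real assume "e < 0"
  then have "e < (\<integral>s. \<bar>indicator B (primitive (Ds j) s) - indicator B (primitive D s)\<bar> \<partial>mu)" for j
    using integral_nonneg_AE[of "\<lambda>s. \<bar>indicator B (primitive (Ds j) s) - indicator B (primitive D s)\<bar>" mu]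
    by (auto intro: less_le_trans)
  then show "\<forall>\<^sub>F j in sequentially. e < (\<integral>s. \<bar>indicator B (primitive (Ds j) s) - indicator B (primitive D s)\<bar> \<partial>mu)"
    by simp
qed

text \<open>This is Scheffe's lemma; it applies because all densities have the same integral.\<close>

lemma increasing_densities_L1:
  assumes Ds: "\<And>j. increasing_density (Ds j)" and D: "increasing_density D"
    and AE: "AE x in mu. (\<lambda>j. Ds j x) \<longlonglongrightarrow> D x"
  shows "(\<lambda>j. \<integral>s. \<bar>Ds j s - D s\<bar> \<partial>mu) \<longlonglongrightarrow> 0"
proof -
  interpret Ds: increasing_density "Ds j" for j by (rule Ds)
  interpret D: increasing_density D by (rule D)
  have mass: "(\<integral>\<^sup>+x. ennreal \<bar>E x\<bar> \<partial>mu) = 1" if "increasing_density E" for E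
  proof -
    interpret E: increasing_density E by (rule that)
    have "(\<integral>\<^sup>+x. ennreal \<bar>E x\<bar> \<partial>mu) = ennreal (\<integral>x. \<bar>E x\<bar> \<partial>mu)"
      using E.D_integrable by (intro nn_integral_eq_integral) auto
    also have "(\<integral>x. \<bar>E x\<bar> \<partial>mu) = 1"
      using E.D_pos E.D_integral by (simp add: less_imp_le)
    finally show ?thesis by simp
  qed
  have "(\<lambda>j. \<integral>\<^sup>+x. norm (Ds j x - D x) \<partial>mu) \<longlonglongrightarrow> 0"
    using D.D_integrable AE by (intro Scheffe_lemma2) (simp_all add: mass[OF Ds] mass[OF D])
  moreover have "(\<integral>\<^sup>+x. norm (Ds j x - D x) \<partial>mu) = ennreal (\<integral>s. \<bar>Ds j s - D s\<bar> \<partial>mu)" for j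
    using D.D_integrable Ds.D_integrable[of j] by (subst nn_integral_eq_integral) auto
  ultimately have "(\<lambda>j. ennreal (\<integral>s. \<bar>Ds j s - D s\<bar> \<partial>mu)) \<longlonglongrightarrow> ennreal 0" by simp
  then show ?thesis by (subst (asm) tendsto_ennreal_iff) (auto intro!: integral_nonneg_AE)
qed

text \<open>Passing to a subsequence turns the \<open>L\<^sup>1\<close> convergence of the indicators of \<open>\<psi>\<^sub>j\<^sup>-\<^sup>1 B\<close> into convergence almost everywhere,
so that dominated convergence applies to the bounded factor \<open>g\<close>. The factor \<open>D\<^sub>j\<close> of the second integral has no
integrable majorant at hand; it is replaced by \<open>D\<close> at the cost of an error bounded by the \<open>L\<^sup>1\<close> distance.\<close>

lemma kappa_integrals_subsequence:
  assumes Ds: "\<And>j. increasing_density (Ds j)" and D: "increasing_density D"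
    and AE: "AE x in mu. (\<lambda>j. Ds j x) \<longlonglongrightarrow> D x"
    and A: "A \<in> sets mu" and B: "B \<in> sets mu"
    and f: "continuous_on {0<..} f" "bounded (f ` {0<..})"
  obtains r :: "nat \<Rightarrow> nat" where "strict_mono r"
    "(\<lambda>j. \<integral>s. indicator (A \<inter> primitive (Ds (r j)) -` B) s * f (Ds (r j) s) \<partial>mu)
      \<longlonglongrightarrow> (\<integral>s. indicator (A \<inter> primitive D -` B) s * f (D s) \<partial>mu)"
    "(\<lambda>j. \<integral>s. indicator (A \<inter> primitive (Ds (r j)) -` B) s * (f (Ds (r j) s) * Ds (r j) s) \<partial>mu)
      \<longlonglongrightarrow> (\<integral>s. indicator (A \<inter> primitive D -` B) s * (f (D s) * D s) \<partial>mu)"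
proof -
  interpret Ds: increasing_density "Ds j" for j by (rule Ds)
  interpret D: increasing_density D by (rule D)
  interpret prob_space mu by (rule prob_space_mu)
  obtain b where b: "\<And>t. 0 < t \<Longrightarrow> \<bar>f t\<bar> \<le> b" using f(2) by (auto simp: bounded_iff)
  have b0: "0 \<le> b" using b[of 1] by linarith
  have fm: "f \<in> borel_measurable borel_pos"
    using f(1) by (rule borel_measurable_continuous_on_restrict)
  have fD[measurable]: "(\<lambda>s. f (E s)) \<in> borel_measurable mu" if "increasing_density E" for E
    using measurable_compose[OF increasing_density.D_borel_pos[OF that] fm] .
  have ind[measurable]: "(\<lambda>s. indicator B (primitive E s) :: real) \<in> borel_measurable mu"
    if "increasing_density E" for E
  proof -
    have "primitive E \<in> mu \<rightarrow>\<^sub>M mu"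
      using increasing_density.primitive_qi[OF that] by (simp add: qi_transformations_def)
    then show ?thesis using B by measurable
  qed
  have split: "indicator (A \<inter> primitive E -` B) s = indicator A s * (indicator B (primitive E s) :: real)" for E s
    by (auto simp: indicator_def)
  have L1: "(\<lambda>j. \<integral>s. \<bar>Ds j s - D s\<bar> \<partial>mu) \<longlonglongrightarrow> 0"
    using Ds D AE by (rule increasing_densities_L1)
  let ?u = "\<lambda>j s. indicator B (primitive (Ds j) s) - indicator B (primitive D s) :: real"
  have "\<exists>r::nat\<Rightarrow>nat. strict_mono r \<and> (AE x in mu. (\<lambda>n. ?u (r n) x) \<longlonglongrightarrow> 0)"
  proof (rule tendsto_L1_AE_subseq)
    show "integrable mu (?u n)" for n
      using ind[OF Ds[of n]] ind[OF D]
      by (intro integrable_const_bound[where B=1]) (auto simp: indicator_def)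
    show "(\<lambda>n. \<integral>x. norm (?u n x) \<partial>mu) \<longlonglongrightarrow> 0"
      using tendsto_measure_vimage_primitive[OF Ds D L1 B] by simp
  qed
  then obtain r :: "nat \<Rightarrow> nat" where r: "strict_mono r" "AE x in mu. (\<lambda>n. ?u (r n) x) \<longlonglongrightarrow> 0"
    by blast
  define g where "g E s = indicator (A \<inter> primitive E -` B) s * f (E s)" for E s
  have gm: "g E \<in> borel_measurable mu" if "increasing_density E" for E
    unfolding g_def split using that A fD ind by (auto intro!: borel_measurable_times borel_measurable_indicator)
  have gb: "\<bar>g E s\<bar> \<le> b" if "increasing_density E" for E s
    using b[OF increasing_density.D_pos[OF that]] b0 by (auto simp: g_def indicator_def)
  have AEr: "AE x in mu. (\<lambda>j. Ds (r j) x) \<longlonglongrightarrow> D x"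
    using AE by eventually_elim (use LIMSEQ_subseq_LIMSEQ[OF _ r(1)] in \<open>auto simp: comp_def\<close>)
  have gAE: "AE s in mu. (\<lambda>j. g (Ds (r j)) s) \<longlonglongrightarrow> g D s"
    using AEr r(2)
  proof eventually_elim
    case (elim s)
    have "isCont f (D s)" using f(1) D.D_pos by (simp add: continuous_on_eq_continuous_at)
    then have "(\<lambda>j. f (Ds (r j) s)) \<longlonglongrightarrow> f (D s)" using elim(1) by (rule isCont_tendsto_compose)
    moreover have "(\<lambda>j. indicator B (primitive (Ds (r j)) s) :: real) \<longlonglongrightarrow> indicator B (primitive D s)"
      using elim(2) by (rule LIM_zero_cancel)
    ultimately show ?case unfolding g_def split by (intro tendsto_intros)
  qed
  have 1: "(\<lambda>j. \<integral>s. g (Ds (r j)) s \<partial>mu) \<longlonglongrightarrow> (\<integral>s. g D s \<partial>mu)"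
    using gAE by (intro integral_dominated_convergence[where w="\<lambda>_. b"]) (auto simp: gm Ds D gb)
  have gDi: "integrable mu (\<lambda>s. g E s * E' s)" if E: "increasing_density E" and E': "increasing_density E'" for E E'
  proof -
    interpret E': increasing_density E' by (rule E')
    show ?thesis
    proof (rule Bochner_Integration.integrable_bound)
      show "integrable mu (\<lambda>s. b * E' s)" using E'.D_integrable by simp
      show "(\<lambda>s. g E s * E' s) \<in> borel_measurable mu"
        using gm[OF E] by (intro borel_measurable_times) auto
      have "norm (g E s * E' s) \<le> norm (b * E' s)" for s
        using mult_right_mono[OF gb[OF E, of s], of "E' s"] b0 E'.D_pos[of s] by (simp add: abs_mult)
      then show "AE s in mu. norm (g E s * E' s) \<le> norm (b * E' s)" by simp
    qed
  qed
  have 2: "(\<lambda>j. \<integral>s. g (Ds (r j)) s * D s \<partial>mu) \<longlonglongrightarrow> (\<integral>s. g D s * D s \<partial>mu)"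
  proof (rule integral_dominated_convergence[where w="\<lambda>s. b * D s"])
    show "AE s in mu. (\<lambda>j. g (Ds (r j)) s * D s) \<longlonglongrightarrow> g D s * D s"
      using gAE by eventually_elim (intro tendsto_intros)
    show "AE s in mu. norm (g (Ds (r j)) s * D s) \<le> b * D s" for j
      using gb[OF Ds] D.D_pos by (auto simp: abs_mult less_imp_le intro!: mult_mono b0)
  qed (use gm[OF D] gm[OF Ds] D.D_integrable in auto)
  have 3: "(\<lambda>j. \<integral>s. g (Ds (r j)) s * (Ds (r j) s - D s) \<partial>mu) \<longlonglongrightarrow> 0"
  proof (rule Lim_null_comparison)
    have "(\<lambda>j. \<integral>s. \<bar>Ds (r j) s - D s\<bar> \<partial>mu) \<longlonglongrightarrow> 0"
      using LIMSEQ_subseq_LIMSEQ[OF L1 r(1)] by (simp add: comp_def)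
    then show "(\<lambda>j. b * (\<integral>s. \<bar>Ds (r j) s - D s\<bar> \<partial>mu)) \<longlonglongrightarrow> 0"
      by (rule tendsto_mult_right_zero)
    have "norm (\<integral>s. g (Ds j) s * (Ds j s - D s) \<partial>mu) \<le> b * (\<integral>s. \<bar>Ds j s - D s\<bar> \<partial>mu)" for j
    proof -
      have "norm (\<integral>s. g (Ds j) s * (Ds j s - D s) \<partial>mu) \<le> (\<integral>s. norm (g (Ds j) s * (Ds j s - D s)) \<partial>mu)"
        by (rule integral_norm_bound)
      also have "\<dots> \<le> (\<integral>s. b * \<bar>Ds j s - D s\<bar> \<partial>mu)"
      proof (rule integral_mono)
        show "integrable mu (\<lambda>s. norm (g (Ds j) s * (Ds j s - D s)))"
          using gDi[OF Ds[of j] Ds[of j]] gDi[OF Ds[of j] D] by (simp add: right_diff_distrib)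
        show "integrable mu (\<lambda>s. b * \<bar>Ds j s - D s\<bar>)"
          using D.D_integrable Ds.D_integrable[of j] by simp
        show "norm (g (Ds j) s * (Ds j s - D s)) \<le> b * \<bar>Ds j s - D s\<bar>" for s
          using gb[OF Ds[of j], of s] by (simp add: abs_mult mult_right_mono)
      qed
      finally show ?thesis by simp
    qed
    then show "\<forall>\<^sub>F j in sequentially. norm (\<integral>s. g (Ds (r j)) s * (Ds (r j) s - D s) \<partial>mu)
        \<le> b * (\<integral>s. \<bar>Ds (r j) s - D s\<bar> \<partial>mu)" by simp
  qed
  have "(\<integral>s. g (Ds j) s * Ds j s \<partial>mu)
      = (\<integral>s. g (Ds j) s * D s \<partial>mu) + (\<integral>s. g (Ds j) s * (Ds j s - D s) \<partial>mu)" for j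
    using gDi[OF Ds[of j] Ds[of j]] gDi[OF Ds[of j] D] by (simp add: right_diff_distrib)
  then have 4: "(\<lambda>j. \<integral>s. g (Ds (r j)) s * Ds (r j) s \<partial>mu) \<longlonglongrightarrow> (\<integral>s. g D s * D s \<partial>mu)"
    using tendsto_add[OF 2 3] by simp
  show ?thesis
    using that[OF r(1)] 1 4 by (simp add: g_def mult.assoc)
qed

section \<open>Initial topologies\<close>

lemma topspace_initial_topology [simp]: "topspace (initial_topology S F T) = S"
  by (auto simp: initial_topology_def topology_generated_by_topspace)

lemma openin_initial_topology:
  "f \<in> F \<Longrightarrow> openin T U \<Longrightarrow> openin (initial_topology S F T) {x \<in> S. f x \<in> U}"
  unfolding initial_topology_def by (rule topology_generated_by_Basis) auto

lemma continuous_map_into_initial_topology: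
  assumes g: "\<And>x. x \<in> topspace X \<Longrightarrow> g x \<in> S"
    and cont: "\<And>f. f \<in> F \<Longrightarrow> continuous_map X T (\<lambda>x. f (g x))"
  shows "continuous_map X (initial_topology S F T) g"
  unfolding initial_topology_def
proof (rule continuous_on_generated_topo)
  fix V assume "V \<in> insert S {{x \<in> S. f x \<in> U} | f U. f \<in> F \<and> openin T U}"
  then consider "V = S" | f U where "V = {x \<in> S. f x \<in> U}" "f \<in> F" "openin T U" by blast
  then show "openin X (g -` V \<inter> topspace X)"
  proof cases
    case 1
    then have "g -` V \<inter> topspace X = topspace X" using g by auto
    then show ?thesis by simp
  next
    case 2
    then have "g -` V \<inter> topspace X = {x \<in> topspace X. f (g x) \<in> U}" using g by auto
    then show ?thesis using openin_continuous_map_preimage[OF cont[OF 2(2)] 2(3)] by simp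
  qed
qed (use g in auto)

lemma continuous_map_weak_topologyI:
  assumes "\<And>x. x \<in> topspace X \<Longrightarrow> g x \<in> finite_measures_pos"
    and "\<And>f. continuous_on {0<..} f \<Longrightarrow> bounded (f ` {0<..}) \<Longrightarrow>
      continuous_map X euclideanreal (\<lambda>x. \<integral>t. f t \<partial>g x)"
  shows "continuous_map X weak_topology g"
  unfolding weak_topology_def using assms by (intro continuous_map_into_initial_topology) auto

lemma topspace_topology_M: "topspace topology_M = measures_M"
  by (simp add: topology_M_def)

lemma continuous_map_topology_M_integral:
  assumes "continuous_on {0<..} f" "bounded (f ` {0<..})"
  shows "continuous_map topology_M euclideanreal (\<lambda>\<nu>. \<integral>t. f t \<partial>\<nu>)"
  unfolding continuous_map_def
proof (intro conjI allI impI)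
  fix U :: "real set" assume U: "openin euclideanreal U"
  let ?W = "{\<nu> \<in> finite_measures_pos. (\<integral>t. f t \<partial>\<nu>) \<in> U}"
  have "openin weak_topology ?W"
    unfolding weak_topology_def
    by (rule openin_initial_topology[OF _ U, where f="\<lambda>\<nu>. \<integral>t. f t \<partial>\<nu>"]) (use assms in auto)
  then have "openin topology_M {\<nu> \<in> measures_M. \<nu> \<in> ?W}"
    unfolding topology_M_def by (intro openin_initial_topology[where f="\<lambda>\<nu>. \<nu>"]) simp_all
  moreover have "{\<nu> \<in> measures_M. \<nu> \<in> ?W} = {\<nu> \<in> topspace topology_M. (\<integral>t. f t \<partial>\<nu>) \<in> U}"
    using prob_space.axioms(1)[OF measures_M_prob_space]
    by (auto simp: topspace_topology_M finite_measures_pos_def measures_M_def)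
  ultimately show "openin topology_M {\<nu> \<in> topspace topology_M. (\<integral>t. f t \<partial>\<nu>) \<in> U}" by simp
qed auto

text \<open>If continuity failed at \<open>x\<close>, then each neighbourhood of \<open>x\<close> given by finitely many of the \<open>\<phi> n\<close> would contain a bad
point, and these points would form a sequence that contradicts the hypothesis. Passing to a subsequence
in the hypothesis is harmless, because every point of the sequence is bad.\<close>

lemma continuous_map_real_by_sequences:
  fixes \<phi> :: "nat \<Rightarrow> 'a \<Rightarrow> real" and \<Psi> :: "'a \<Rightarrow> real"
  assumes cont: "\<And>n. continuous_map X euclideanreal (\<phi> n)"
    and seq: "\<And>x s. x \<in> topspace X \<Longrightarrow> (\<And>j::nat. s j \<in> topspace X) \<Longrightarrow>
      (\<And>n. (\<lambda>j. \<phi> n (s j)) \<longlonglongrightarrow> \<phi> n x) \<Longrightarrow>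
      \<exists>r::nat \<Rightarrow> nat. strict_mono r \<and> (\<lambda>j. \<Psi> (s (r j))) \<longlonglongrightarrow> \<Psi> x"
  shows "continuous_map X euclideanreal \<Psi>"
  unfolding continuous_map_def
proof (intro conjI allI impI)
  fix U :: "real set" assume "openin euclideanreal U"
  then have U: "open U" by simp
  let ?S = "{y \<in> topspace X. \<Psi> y \<in> U}"
  show "openin X ?S"
  proof (subst openin_subopen, intro ballI)
    fix x assume x: "x \<in> ?S"
    define W where "W j = (\<Inter>n\<in>{..j}. {y \<in> topspace X. \<phi> n y \<in> ball (\<phi> n x) (inverse (Suc j))}) \<inter> topspace X" for j
    have "openin X {y \<in> topspace X. \<phi> n y \<in> ball (\<phi> n x) (inverse (Suc j))}" for n j
      by (rule openin_continuous_map_preimage[OF cont]) simp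
    then have W: "openin X (W j)" for j unfolding W_def by (intro openin_INT) auto
    have xW: "x \<in> W j" for j using x by (simp add: W_def)
    have "\<exists>j. W j \<subseteq> ?S"
    proof (rule ccontr)
      assume "\<nexists>j. W j \<subseteq> ?S"
      then have "\<forall>j. \<exists>y. y \<in> W j \<and> y \<notin> ?S" by blast
      then obtain s where s: "\<And>j. s j \<in> W j" "\<And>j. s j \<notin> ?S" by metis
      have sX: "s j \<in> topspace X" for j using s(1)[of j] by (simp add: W_def)
      have "(\<lambda>j. \<phi> n (s j)) \<longlonglongrightarrow> \<phi> n x" for n
      proof (rule metric_tendsto_imp_tendsto[OF LIMSEQ_inverse_real_of_nat])
        have "dist (\<phi> n (s j)) (\<phi> n x) \<le> dist (inverse (real (Suc j))) 0" if "n \<le> j" for j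
          using s(1)[of j] that by (auto simp: W_def dist_commute intro!: less_imp_le)
        then show "\<forall>\<^sub>F j in sequentially. dist (\<phi> n (s j)) (\<phi> n x) \<le> dist (inverse (real (Suc j))) 0"
          using eventually_ge_at_top[of n] by (rule eventually_mono[rotated])
      qed
      then obtain r :: "nat \<Rightarrow> nat" where "(\<lambda>j. \<Psi> (s (r j))) \<longlonglongrightarrow> \<Psi> x"
        using seq[of x s] x sX by auto
      then have "\<forall>\<^sub>F j in sequentially. \<Psi> (s (r j)) \<in> U"
        using U x by (intro topological_tendstoD) auto
      then obtain j where "\<Psi> (s (r j)) \<in> U" using eventually_happens' by fastforce
      then show False using s(2)[of "r j"] sX by simp
    qed
    then show "\<exists>T. openin X T \<and> x \<in> T \<and> T \<subseteq> ?S" using W xW by blast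
  qed
qed auto

section \<open>The measures kappa of a primitive\<close>

context increasing_density
begin

lemma kappa_domain_sets:
  assumes "A \<in> sets mu" "B \<in> sets mu"
  shows "A \<inter> primitive D -` B \<in> sets mu"
proof -
  have "A \<subseteq> {0..1}" using sets.sets_into_space[OF assms(1)] by simp
  then have "A \<inter> primitive D -` B = A \<inter> (primitive D -` B \<inter> {0..1})" by auto
  then show ?thesis using assms(1) vimage_sets[OF assms(2)] by simp
qed

text \<open>In \<^const>\<open>kappa\<close> the Radon-Nikodym derivative may be replaced by \<open>D\<close>, which equals it almost everywhere.\<close>

lemma kappa_primitive:
  assumes "A \<in> sets mu" "B \<in> sets mu"
  shows "kappa (primitive D) A B
    = distr (density mu (\<lambda>x. ennreal (indicator (A \<inter> primitive D -` B) x))) borel_pos D"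
proof -
  define C where "C = A \<inter> primitive D -` B"
  have C: "C \<in> sets mu" unfolding C_def using assms by (rule kappa_domain_sets)
  let ?N = "distr (density mu (\<lambda>x. ennreal (indicator C x))) borel_pos D"
  have Cm: "(\<lambda>x. ennreal (indicator C x)) \<in> borel_measurable mu" using C by simp
  have "emeasure mu {x \<in> A \<inter> primitive D -` B. rn_derivative (primitive D) x \<in> E} = emeasure ?N E"
    if E: "E \<in> sets borel_pos" for E
  proof -
    have DE: "D -` E \<inter> {0..1} \<in> sets mu" using measurable_sets[OF D_borel_pos E] by simp
    have "emeasure ?N E = emeasure (density mu (\<lambda>x. ennreal (indicator C x))) (D -` E \<inter> {0..1})"
      using D_borel_pos E by (subst emeasure_distr) auto
    also have "\<dots> = (\<integral>\<^sup>+x. indicator (C \<inter> (D -` E \<inter> {0..1})) x \<partial>mu)"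
      using Cm DE by (subst emeasure_density) (auto intro!: nn_integral_cong simp: indicator_def)
    also have "\<dots> = emeasure mu (C \<inter> (D -` E \<inter> {0..1}))"
      using C DE by (intro nn_integral_indicator) auto
    also have "\<dots> = emeasure mu {x \<in> A \<inter> primitive D -` B. rn_derivative (primitive D) x \<in> E}"
    proof (rule emeasure_eq_AE)
      show AE: "AE x in mu. x \<in> C \<inter> (D -` E \<inter> {0..1}) \<longleftrightarrow>
          x \<in> {x \<in> A \<inter> primitive D -` B. rn_derivative (primitive D) x \<in> E}"
        using rn_derivative_primitive AE_space[of mu] by eventually_elim (auto simp: C_def)
      show meas: "C \<inter> (D -` E \<inter> {0..1}) \<in> sets mu" using C DE by auto
      show "{x \<in> A \<inter> primitive D -` B. rn_derivative (primitive D) x \<in> E} \<in> sets mu"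
        by (rule sets_mu_AE_eq[OF meas _ AE]) (use sets.sets_into_space[OF assms(1)] in auto)
    qed
    finally show ?thesis by simp
  qed
  moreover have sig: "sigma_sets {0<..} (sets borel_pos) = sets borel_pos"
    "sets borel_pos \<subseteq> Pow {0<..}"
    using sets.sigma_sets_eq[of borel_pos] sets.space_closed[of borel_pos]
    by (simp_all add: space_restrict_space)
  ultimately have "kappa (primitive D) A B = measure_of {0<..} (sets borel_pos) (emeasure ?N)"
    unfolding kappa_def by (intro measure_of_eq) blast+
  also have "\<dots> = ?N"
    using measure_of_of_measure[of ?N] by (simp add: space_restrict_space)
  finally show ?thesis by (simp add: C_def)
qed

lemma
  assumes AB: "A \<in> sets mu" "B \<in> sets mu"
  shows kappa_finite: "kappa (primitive D) A B \<in> finite_measures_pos"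
    and times_t_kappa_finite: "times_t (kappa (primitive D) A B) \<in> finite_measures_pos"
proof -
  define C where "C = A \<inter> primitive D -` B"
  have C: "C \<in> sets mu" unfolding C_def using AB by (rule kappa_domain_sets)
  have Cm: "(\<lambda>x. ennreal (indicator C x)) \<in> borel_measurable mu" using C by simp
  let ?N = "distr (density mu (\<lambda>x. ennreal (indicator C x))) borel_pos D"
  have \<kappa>: "kappa (primitive D) A B = ?N" unfolding C_def using AB by (rule kappa_primitive)
  have Dm: "D \<in> density mu (\<lambda>x. ennreal (indicator C x)) \<rightarrow>\<^sub>M borel_pos" using D_borel_pos by simp
  have nn: "(\<integral>\<^sup>+t. g t \<partial>?N) \<le> (\<integral>\<^sup>+x. g (D x) \<partial>mu)" if g: "g \<in> borel_measurable borel_pos" for g :: "real \<Rightarrow> ennreal"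
  proof -
    have gD: "(\<lambda>x. g (D x)) \<in> borel_measurable mu" using measurable_compose[OF D_borel_pos g] .
    have "(\<integral>\<^sup>+t. g t \<partial>?N) = (\<integral>\<^sup>+x. g (D x) \<partial>density mu (\<lambda>x. ennreal (indicator C x)))"
      using Dm g by (simp add: nn_integral_distr)
    also have "\<dots> = (\<integral>\<^sup>+x. ennreal (indicator C x) * g (D x) \<partial>mu)"
      using Cm gD by (rule nn_integral_density)
    also have "\<dots> \<le> (\<integral>\<^sup>+x. g (D x) \<partial>mu)"
      by (intro nn_integral_mono) (auto simp: indicator_def)
    finally show ?thesis .
  qed
  have "emeasure ?N (space ?N) \<le> 1"
    using nn[of "\<lambda>_. 1"] by (simp add: emeasure_restrict_space)
  then have "finite_measure ?N" by (intro finite_measureI) (auto simp: top_unique)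
  then show "kappa (primitive D) A B \<in> finite_measures_pos"
    by (simp add: \<kappa> finite_measures_pos_def)
  have em: "(\<lambda>t. ennreal t) \<in> borel_measurable borel_pos" by (intro measurable_restrict_space1) simp
  have "emeasure (times_t ?N) (space (times_t ?N)) = (\<integral>\<^sup>+t. ennreal t \<partial>?N)"
  proof -
    have "emeasure (times_t ?N) (space (times_t ?N)) = (\<integral>\<^sup>+t. ennreal t * indicator {0<..} t \<partial>?N)"
      unfolding times_t_def using em sets.top[of borel_pos]
      by (subst emeasure_density) (simp_all add: space_restrict_space)
    also have "\<dots> = (\<integral>\<^sup>+t. ennreal t \<partial>?N)"
      by (rule nn_integral_cong) (simp add: space_restrict_space)
    finally show ?thesis .
  qed
  also have "\<dots> \<le> (\<integral>\<^sup>+x. ennreal (D x) \<partial>mu)" using em by (rule nn)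
  also have "\<dots> = 1"
    using D_integrable D_integral D_pos by (subst nn_integral_eq_integral) (auto simp: less_imp_le)
  finally have "finite_measure (times_t ?N)" by (intro finite_measureI) (auto simp: top_unique)
  then show "times_t (kappa (primitive D) A B) \<in> finite_measures_pos"
    by (simp add: \<kappa> finite_measures_pos_def times_t_def)
qed

lemma
  fixes f :: "real \<Rightarrow> real"
  assumes AB: "A \<in> sets mu" "B \<in> sets mu" and f: "f \<in> borel_measurable borel_pos"
  shows integral_kappa: "(\<integral>t. f t \<partial>kappa (primitive D) A B)
      = (\<integral>s. indicator (A \<inter> primitive D -` B) s * f (D s) \<partial>mu)"
    and integral_times_t_kappa: "(\<integral>t. f t \<partial>times_t (kappa (primitive D) A B))
      = (\<integral>s. indicator (A \<inter> primitive D -` B) s * (f (D s) * D s) \<partial>mu)"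
proof -
  define C where "C = A \<inter> primitive D -` B"
  have C: "C \<in> sets mu" unfolding C_def using AB by (rule kappa_domain_sets)
  let ?N = "distr (density mu (\<lambda>x. ennreal (indicator C x))) borel_pos D"
  have \<kappa>: "kappa (primitive D) A B = ?N" unfolding C_def using AB by (rule kappa_primitive)
  have Dm: "D \<in> density mu (\<lambda>x. ennreal (indicator C x)) \<rightarrow>\<^sub>M borel_pos" using D_borel_pos by simp
  have int: "(\<integral>t. g t \<partial>?N) = (\<integral>s. indicator C s * g (D s) \<partial>mu)"
    if g: "g \<in> borel_measurable borel_pos" for g :: "real \<Rightarrow> real"
  proof -
    have gD: "(\<lambda>x. g (D x)) \<in> borel_measurable mu" using measurable_compose[OF D_borel_pos g] .
    have "(\<integral>t. g t \<partial>?N) = (\<integral>x. g (D x) \<partial>density mu (\<lambda>x. ennreal (indicator C x)))"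
      using Dm g by (rule integral_distr)
    also have "\<dots> = (\<integral>s. indicator C s *\<^sub>R g (D s) \<partial>mu)"
      using gD C by (intro integral_density) auto
    finally show ?thesis by simp
  qed
  show "(\<integral>t. f t \<partial>kappa (primitive D) A B)
      = (\<integral>s. indicator (A \<inter> primitive D -` B) s * f (D s) \<partial>mu)"
    using int[OF f] by (simp add: \<kappa> C_def)
  have idm: "(\<lambda>t. t) \<in> borel_measurable borel_pos" by (intro measurable_restrict_space1) simp
  have "(\<integral>t. f t \<partial>times_t ?N) = (\<integral>t. t *\<^sub>R f t \<partial>?N)"
    unfolding times_t_def using f idm
    by (intro integral_density) (auto simp: space_restrict_space intro!: AE_I2)
  also have "\<dots> = (\<integral>t. f t * t \<partial>?N)" by (simp add: mult.commute)
  also have "\<dots> = (\<integral>s. indicator C s * (f (D s) * D s) \<partial>mu)"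
    using f idm by (intro int borel_measurable_times)
  finally show "(\<integral>t. f t \<partial>times_t (kappa (primitive D) A B))
      = (\<integral>s. indicator (A \<inter> primitive D -` B) s * (f (D s) * D s) \<partial>mu)"
    by (simp add: \<kappa> C_def)
qed

end

section \<open>Continuity\<close>

text \<open>Any increasing density with distribution \<open>\<nu>\<close> will do, since all of them have the same primitive.\<close>

definition quantile_density :: "real measure \<Rightarrow> real \<Rightarrow> real"
  where "quantile_density \<nu> = (SOME D. increasing_density D \<and> distr mu borel_pos D = \<nu>)"

lemma quantile_density:
  assumes "\<nu> \<in> measures_M"
  shows "increasing_density (quantile_density \<nu>)" "distr mu borel_pos (quantile_density \<nu>) = \<nu>"
proof -
  have "\<exists>D. increasing_density D \<and> distr mu borel_pos D = \<nu>"
    using measures_M_quantile[OF assms] by metis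
  then have "increasing_density (quantile_density \<nu>) \<and> distr mu borel_pos (quantile_density \<nu>) = \<nu>"
    unfolding quantile_density_def by (rule someI_ex)
  then show "increasing_density (quantile_density \<nu>)" "distr mu borel_pos (quantile_density \<nu>) = \<nu>"
    by auto
qed

lemma the_class_G_function:
  assumes "\<nu> \<in> measures_M"
  shows "(THE \<psi>. \<psi> \<in> class_G \<and> deriv_distribution \<psi> = \<nu>) = primitive (quantile_density \<nu>)"
proof (rule the1_equality[OF measures_M_ex1[OF assms]])
  interpret increasing_density "quantile_density \<nu>" by (rule quantile_density[OF assms])
  show "primitive (quantile_density \<nu>) \<in> class_G \<and> deriv_distribution (primitive (quantile_density \<nu>)) = \<nu>"
    using primitive_in_class_G deriv_distribution_primitive quantile_density(2)[OF assms] by simp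
qed

lemma cts_step_test_function:
  assumes "p < q"
  shows "continuous_on {0<..} (cts_step p q)" "bounded (cts_step p q ` {0<..})"
proof -
  show "continuous_on {0<..} (cts_step p q)"
    using uniformly_continuous_imp_continuous[OF cts_step_uniformly_continuous[OF assms]]
    by (rule continuous_on_subset) simp
  have "\<bar>cts_step p q t\<bar> \<le> 1" for t using assms by (auto simp: cts_step_def)
  then show "bounded (cts_step p q ` {0<..})" by (auto simp: bounded_iff)
qed

text \<open>A functional of increasing densities is continuous in the distribution as soon as it is
continuous along almost everywhere convergent sequences. The countable family of test functions that makes this
reduction possible consists of the steps between rational points.\<close>

lemma continuous_map_topology_M_sequentially:
  fixes \<Phi> :: "(real \<Rightarrow> real) \<Rightarrow> real"
  assumes "\<And>Ds D. (\<And>j::nat. increasing_density (Ds j)) \<Longrightarrow> increasing_density D \<Longrightarrow>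
      AE x in mu. (\<lambda>j. Ds j x) \<longlonglongrightarrow> D x \<Longrightarrow>
      \<exists>r::nat \<Rightarrow> nat. strict_mono r \<and> (\<lambda>j. \<Phi> (Ds (r j))) \<longlonglongrightarrow> \<Phi> D"
  shows "continuous_map topology_M euclideanreal (\<lambda>\<nu>. \<Phi> (quantile_density \<nu>))"
proof -
  define I :: "(real \<times> real) set" where "I = {(p, q). p \<in> \<rat> \<and> q \<in> \<rat> \<and> p < q}"
  have "I \<subseteq> \<rat> \<times> \<rat>" by (auto simp: I_def)
  then have cI: "countable I" using countable_rat countable_SIGMA countable_subset by metis
  have "(0, 1) \<in> I" by (simp add: I_def)
  then have I0: "I \<noteq> {}" by auto
  define step where "step n = (case from_nat_into I n of (p, q) \<Rightarrow> cts_step p q)" for n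
  show ?thesis
  proof (rule continuous_map_real_by_sequences)
    fix n
    obtain p q where pq: "from_nat_into I n = (p, q)" by fastforce
    then have "p < q" using from_nat_into[OF I0, of n] by (simp add: I_def)
    then show "continuous_map topology_M euclideanreal (\<lambda>\<nu>. \<integral>t. step n t \<partial>\<nu>)"
      using cts_step_test_function[of p q] by (simp add: step_def pq continuous_map_topology_M_integral)
  next
    fix \<nu> and s :: "nat \<Rightarrow> real measure"
    assume \<nu>: "\<nu> \<in> topspace topology_M" and s: "\<And>j. s j \<in> topspace topology_M"
      and conv: "\<And>n. (\<lambda>j. \<integral>t. step n t \<partial>s j) \<longlonglongrightarrow> (\<integral>t. step n t \<partial>\<nu>)"
    have \<nu>M: "\<nu> \<in> measures_M" and sM: "\<And>j. s j \<in> measures_M"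
      using \<nu> s by (simp_all add: topspace_topology_M)
    let ?D = "quantile_density \<nu>" and ?Ds = "\<lambda>j. quantile_density (s j)"
    have D: "increasing_density ?D" and Ds: "\<And>j. increasing_density (?Ds j)"
      using quantile_density(1) \<nu>M sM by auto
    have int: "(\<integral>x. cts_step p q (quantile_density \<nu>' x) \<partial>mu) = (\<integral>t. cts_step p q t \<partial>\<nu>')"
      if "\<nu>' \<in> measures_M" for p q \<nu>'
      using integral_distribution[OF quantile_density(1)[OF that] cts_step_borel_pos] quantile_density(2)[OF that]
      by simp
    have "AE x in mu. (\<lambda>j. ?Ds j x) \<longlonglongrightarrow> ?D x"
      using AE_mu_isCont[OF increasing_density.D_mono[OF D]]
    proof eventually_elim
      case (elim x)
      show ?case
      proof (rule increasing_densities_converge[OF Ds D])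
        fix p q :: real assume "p \<in> \<rat>" "q \<in> \<rat>" "p < q"
        then have "(p, q) \<in> I" by (simp add: I_def)
        then obtain n where "from_nat_into I n = (p, q)"
          using from_nat_into_surj[OF cI] by blast
        then show "(\<lambda>j. \<integral>x. cts_step p q (?Ds j x) \<partial>mu) \<longlonglongrightarrow> (\<integral>x. cts_step p q (?D x) \<partial>mu)"
          using conv[of n] by (simp add: step_def int \<nu>M sM)
      qed (use elim in auto)
    qed
    then show "\<exists>r::nat \<Rightarrow> nat. strict_mono r \<and>
        (\<lambda>j. \<Phi> (quantile_density (s (r j)))) \<longlonglongrightarrow> \<Phi> (quantile_density \<nu>)"
      using assms[of ?Ds ?D] Ds D by blast
  qed
qed

theorem proposition1p7:
  shows "(\<forall>\<nu>\<in>measures_M. \<exists>!\<psi>. \<psi> \<in> class_G \<and> deriv_distribution \<psi> = \<nu>) \<and>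
    continuous_map topology_M topology_Gms
      (\<lambda>\<nu>. ae_equal `` {THE \<psi>. \<psi> \<in> class_G \<and> deriv_distribution \<psi> = \<nu>})"
proof
  show "\<forall>\<nu>\<in>measures_M. \<exists>!\<psi>. \<psi> \<in> class_G \<and> deriv_distribution \<psi> = \<nu>"
    using measures_M_ex1 by blast
  let ?\<psi> = "\<lambda>\<nu>. primitive (quantile_density \<nu>)"
  have qi: "?\<psi> \<nu> \<in> qi_transformations" if "\<nu> \<in> measures_M" for \<nu>
    using increasing_density.primitive_qi[OF quantile_density(1)[OF that]] .
  have kappa_psi: "kappa_class (ae_equal `` {?\<psi> \<nu>}) A B = kappa (?\<psi> \<nu>) A B"
    if "\<nu> \<in> topspace topology_M" "A \<in> sets mu" "B \<in> sets mu" for \<nu> A B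
    using that qi by (simp add: kappa_class_eq topspace_topology_M)
  have inc: "increasing_density (quantile_density \<nu>)" if "\<nu> \<in> topspace topology_M" for \<nu>
    using that quantile_density(1) by (simp add: topspace_topology_M)
  have k1: "continuous_map topology_M weak_topology (\<lambda>\<nu>. kappa (?\<psi> \<nu>) A B)"
    and k2: "continuous_map topology_M weak_topology (\<lambda>\<nu>. times_t (kappa (?\<psi> \<nu>) A B))"
    if AB: "A \<in> sets mu" "B \<in> sets mu" for A B
  proof -
    have "continuous_map topology_M euclideanreal (\<lambda>\<nu>. \<integral>t. f t \<partial>kappa (?\<psi> \<nu>) A B)"
      and "continuous_map topology_M euclideanreal (\<lambda>\<nu>. \<integral>t. f t \<partial>times_t (kappa (?\<psi> \<nu>) A B))"
      if f: "continuous_on {0<..} f" "bounded (f ` {0<..})" for f :: "real \<Rightarrow> real"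
    proof -
      have fm: "f \<in> borel_measurable borel_pos"
        using f(1) by (rule borel_measurable_continuous_on_restrict)
      note int1 = increasing_density.integral_kappa[OF _ AB fm]
      note int2 = increasing_density.integral_times_t_kappa[OF _ AB fm]
      show "continuous_map topology_M euclideanreal (\<lambda>\<nu>. \<integral>t. f t \<partial>kappa (?\<psi> \<nu>) A B)"
      proof (rule continuous_map_topology_M_sequentially[where \<Phi>="\<lambda>D. \<integral>t. f t \<partial>kappa (primitive D) A B"])
        fix Ds :: "nat \<Rightarrow> real \<Rightarrow> real" and D
        assume Ds: "\<And>j. increasing_density (Ds j)" and D: "increasing_density D"
          and AE: "AE x in mu. (\<lambda>j. Ds j x) \<longlonglongrightarrow> D x"
        show "\<exists>r. strict_mono r \<and> (\<lambda>j. \<integral>t. f t \<partial>kappa (primitive (Ds (r j))) A B)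
            \<longlonglongrightarrow> (\<integral>t. f t \<partial>kappa (primitive D) A B)"
          by (rule kappa_integrals_subsequence[OF Ds D AE AB f]) (use int1[OF Ds] int1[OF D] in auto)
      qed
      show "continuous_map topology_M euclideanreal (\<lambda>\<nu>. \<integral>t. f t \<partial>times_t (kappa (?\<psi> \<nu>) A B))"
      proof (rule continuous_map_topology_M_sequentially[where \<Phi>="\<lambda>D. \<integral>t. f t \<partial>times_t (kappa (primitive D) A B)"])
        fix Ds :: "nat \<Rightarrow> real \<Rightarrow> real" and D
        assume Ds: "\<And>j. increasing_density (Ds j)" and D: "increasing_density D"
          and AE: "AE x in mu. (\<lambda>j. Ds j x) \<longlonglongrightarrow> D x"
        show "\<exists>r. strict_mono r \<and> (\<lambda>j. \<integral>t. f t \<partial>times_t (kappa (primitive (Ds (r j))) A B))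
            \<longlonglongrightarrow> (\<integral>t. f t \<partial>times_t (kappa (primitive D) A B))"
          by (rule kappa_integrals_subsequence[OF Ds D AE AB f]) (use int2[OF Ds] int2[OF D] in auto)
      qed
    qed
    then show "continuous_map topology_M weak_topology (\<lambda>\<nu>. kappa (?\<psi> \<nu>) A B)"
      and "continuous_map topology_M weak_topology (\<lambda>\<nu>. times_t (kappa (?\<psi> \<nu>) A B))"
      using AB increasing_density.kappa_finite[OF inc] increasing_density.times_t_kappa_finite[OF inc]
      by (auto intro!: continuous_map_weak_topologyI)
  qed
  have "continuous_map topology_M topology_Gms (\<lambda>\<nu>. ae_equal `` {?\<psi> \<nu>})"
    unfolding topology_Gms_def
  proof (rule continuous_map_into_initial_topology)
    show "ae_equal `` {?\<psi> \<nu>} \<in> Gms" if "\<nu> \<in> topspace topology_M" for \<nu>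
      using that qi by (auto simp: Gms_def topspace_topology_M intro: quotientI)
    fix F assume "F \<in> {(\<lambda>C. kappa_class C A B) | A B. A \<in> sets mu \<and> B \<in> sets mu} \<union>
        {(\<lambda>C. times_t (kappa_class C A B)) | A B. A \<in> sets mu \<and> B \<in> sets mu}"
    then obtain A B where AB: "A \<in> sets mu" "B \<in> sets mu"
      and F: "F = (\<lambda>C. kappa_class C A B) \<or> F = (\<lambda>C. times_t (kappa_class C A B))" by blast
    from F show "continuous_map topology_M weak_topology (\<lambda>\<nu>. F (ae_equal `` {?\<psi> \<nu>}))"
      by (elim disjE)
         (auto intro: continuous_map_eq[OF k1[OF AB]] continuous_map_eq[OF k2[OF AB]] simp: kappa_psi AB)
  qed
  then show "continuous_map topology_M topology_Gms
      (\<lambda>\<nu>. ae_equal `` {THE \<psi>. \<psi> \<in> class_G \<and> deriv_distribution \<psi> = \<nu>})"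
    by (rule continuous_map_eq) (simp add: the_class_G_function topspace_topology_M)
qed

end
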